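(* In the setting described in the context, let $\gamma,\nu,\lambda>0$, $T>0$, and suppose $t\mapsto(\theta_t,\eta_t,\xi_t)$ solves on $[0,T]$ the NPDG flow $$\dot\eta_t=M_d(\eta_t)^\dagger\nabla_\eta\mathscr E(u_{\theta_t},\varphi_{\eta_t},\psi_{\xi_t}),\quad \dot\xi_t=M_{bdd}(\xi_t)^\dagger\nabla_\xi\mathscr E(u_{\theta_t},\varphi_{\eta_t},\psi_{\xi_t}),\quad \dot\theta_t=-M_p(\theta_t)^\dagger\nabla_\theta\mathscr E(u_{\theta},\widetilde\varphi_t,\widetilde\psi_t)\big|_{\theta=\theta_t},$$ where $\widetilde\varphi_t=\varphi_{\eta_t}+\gamma\frac{d}{dt}\varphi_{\eta_t}$ and $\widetilde\psi_t=\psi_{\xi_t}+\gamma\frac{d}{dt}\psi_{\xi_t}$ (held fixed when differentiating in $\theta$). Let $\alpha,\beta_1,\beta_2\in[0,1]$ be constants quantifying the relative approximation errors along the flow on $[0,T]$, as defined in the context, and let $\widetilde\kappa=\frac{\max\{L_1,1\}}{\min\{L_0,1\}}$. Suppose $\alpha+\beta_1<\frac1{\widetilde\kappa^2}$, $\beta_2<1$, and $$\Big(\frac1{\widetilde\kappa^2}-(\alpha+\beta_1)\Big)(1-\beta_2)>\frac{\big((1+\beta_1)\gamma\nu+\beta_2+\alpha|1-\gamma\nu|\big)^2}{4\gamma\nu}.$$ Then there exists a constant $r>0$ such that $$\|\mathcal M_p(u_{\theta_t}-u_* )\|_{L^2(\Omega;\mathbb R^r)}^2+\lambda\|\mathcal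 B(u_{\theta_t}-u_* )\|_{L^2(\partial\Omega)}^2\le 2\exp(-rt)\,C_0\qquad\text{for all }0\le t\le T,$$ where $C_0\ge0$ is a constant depending on the initial value $(\theta_0,\eta_0,\xi_0)$ of the flow, and the rate $r$ is explicitly $$r=\tfrac12\Big(\Gamma_{UU}+\Gamma_{\Phi\Phi}-\sqrt{(\Gamma_{UU}-\Gamma_{\Phi\Phi})^2+\Gamma_{\Phi U}^2}\Big),$$ with $\Gamma_{UU}=\gamma\big(\min\{L_0,1\}^2-\max\{L_1,1\}^2(\alpha+\beta_1)\big)$, $\Gamma_{\Phi\Phi}=\nu(1-\beta_2)$, $\Gamma_{\Phi U}=-\max\{L_1,1\}\big((1+\beta_1)\gamma\nu+\beta_2+\alpha|1-\gamma\nu|\big)$. (The exponent $r$ in $\mathbb R^r$ denotes a fixed positive integer, unrelated to the rate $r$.)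
   Context: **PDE and operator splitting.** $\Omega\subset\mathbb R^d$ is a bounded open domain with Lipschitz boundary. $\mathbb H$ is a Hilbert space of functions on $\Omega$; $\mathcal L:\mathbb H\to\mathbb K\subseteq L^2(\Omega)$ is a linear differential operator and $\mathcal B:\mathbb H\to\mathbb K_{\partial\Omega}\subseteq L^2(\partial\Omega)$ a linear boundary operator ($\mathbb K,\mathbb K_{\partial\Omega}$ Hilbert spaces). The PDE is $\mathcal Lu=f$ on $\Omega$, $\mathcal Bu=g$ on $\partial\Omega$, with solution $u_*\in\mathbb H$. There are subspaces $\widetilde{\mathbb H},\widetilde{\mathbb K},\widetilde{\mathbb K}^{test}\subseteq L^2(\Omega;\mathbb R^r)$, $\mathbb K^{test}\subseteq L^2(\Omega)$, $\mathbb K^{test}_{\partial\Omega}\subseteq L^2(\partial\Omega)$ and linear operators $\mathcal M_p:\mathbb H\to\widetilde{\mathbb H}$, $\widetilde{\mathcal L}:\widetilde{\mathbb H}\to\widetilde{\mathbb K}$, $\mathcal M_d^*:\widetilde{\mathbb K}\to\mathbb K$, $\mathcal M_d:\mathbb K^{test}\to\widetilde{\mathbb K}^{test}$ with $\mathcal L=\mathcal M_d^*\widetilde{\mathcal L}\mathcal M_p$ and $\langle\mathcal M_d^*\mathbf u,\varphi\rangle_{L^2(\Omega)}=\langle\mathbf u,\mathcal M_d\varphi\rangle_{L^2(\Omega;\mathbb R^r)}$ for all $\mathbf u\in\widetilde{\mathbb K},\varphi\in\mathbb K^{test}$. There are constants $0<L_0\le L_1<\infty$ with $L_0\|\mathbf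 u\|_{L^2}\le\|\widetilde{\mathcal L}\mathbf u\|_{L^2}\le L_1\|\mathbf u\|_{L^2}$ for all $\mathbf u\in\widetilde{\mathbb H}$. The operator $\widetilde{\mathcal L}$ has an adjoint $\widetilde{\mathcal L}^*$ in the sense $\langle\widetilde{\mathcal L}v,w\rangle_{L^2(\Omega;\mathbb R^r)}=\langle v,\widetilde{\mathcal L}^*w\rangle_{L^2(\Omega;\mathbb R^r)}$ for $v\in\widetilde{\mathbb H}$, $w\in\widetilde{\mathbb K}^{test}$. **Functional.** For $\nu,\lambda>0$, $u\in\mathbb H$, $\varphi\in\mathbb K^{test}$, $\psi\in\mathbb K^{test}_{\partial\Omega}$, $$\mathscr E(u,\varphi,\psi)=\langle\widetilde{\mathcal L}\mathcal M_pu,\mathcal M_d\varphi\rangle_{L^2(\Omega;\mathbb R^r)}-\langle f,\varphi\rangle_{L^2(\Omega)}+\lambda\langle\mathcal Bu-g,\psi\rangle_{L^2(\partial\Omega)}-\tfrac\nu2\big(\|\mathcal M_d\varphi\|_{L^2(\Omega;\mathbb R^r)}^2+\lambda\|\psi\|_{L^2(\partial\Omega)}^2\big).$$ **Parametrization.** $u_\theta\in\mathbb H$, $\varphi_\eta\in\mathbb K^{test}$, $\psi_\xi\in\mathbb K^{test}_{\partial\Omega}$ are parametrized families with $\theta,\eta,\xi$ in open sets of $\mathbb R^{m_\theta},\mathbb R^{m_\eta},\mathbb R^{m_\xi}$. It is assumed that $\mathcal M_p(u_\theta-u_* )$, $\mathcal B(u_\theta-u_* )$, $\mathcal M_d\varphi_\eta$,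 $\psi_\xi$ are differentiable in the parameters (as $L^2$-valued maps), with partial derivatives lying in $\widetilde{\mathbb H}$, $\mathbb K_{\partial\Omega}$, $\widetilde{\mathbb K}^{test}$, $\mathbb K^{test}_{\partial\Omega}$ respectively. **Gram matrices.** $(M_p(\theta))_{ij}=\langle\partial_{\theta_i}\mathcal M_pu_\theta,\partial_{\theta_j}\mathcal M_pu_\theta\rangle_{L^2(\Omega;\mathbb R^r)}+\lambda\langle\partial_{\theta_i}\mathcal Bu_\theta,\partial_{\theta_j}\mathcal Bu_\theta\rangle_{L^2(\partial\Omega)}$; $(M_d(\eta))_{ij}=\langle\partial_{\eta_i}\mathcal M_d\varphi_\eta,\partial_{\eta_j}\mathcal M_d\varphi_\eta\rangle_{L^2(\Omega;\mathbb R^r)}$; $(M_{bdd}(\xi))_{ij}=\lambda\langle\partial_{\xi_i}\psi_\xi,\partial_{\xi_j}\psi_\xi\rangle_{L^2(\partial\Omega)}$. $^\dagger$ is the Moore–Penrose inverse. **Relative errors.** Let $\mathbb L^2=L^2(\Omega;\mathbb R^r)\times L^2(\partial\Omega)$, $\mathbf U_\theta=(\mathcal M_p(u_\theta-u_* ),\sqrt\lambda\,\mathcal B(u_\theta-u_* ))\in\mathbb L^2$, $\boldsymbol\Phi_{\eta,\xi}=(\mathcal M_d\varphi_\eta,\sqrt\lambda\,\psi_\xi)\in\mathbb L^2$, and $(\widetilde{\mathcal L}\oplus\mathrm{Id})(\mathbf v,w)=(\widetilde{\mathcal L}\mathbf v,w)$. Let $\partial\mathbf U_\theta=\mathrm{span}\{(\partial_{\theta_k}\mathcal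 M_pu_\theta,\sqrt\lambda\,\partial_{\theta_k}\mathcal Bu_\theta)\}_{k=1}^{m_\theta}$ and $\partial\boldsymbol\Phi_{\eta,\xi}=\mathrm{span}\{\partial_{\eta_k}\mathcal M_d\varphi_\eta\}_{k=1}^{m_\eta}\times\mathrm{span}\{\sqrt\lambda\,\partial_{\xi_k}\psi_\xi\}_{k=1}^{m_\xi}$, subspaces of $\mathbb L^2$; $\Pi_{V^\perp}$ is the $\mathbb L^2$-orthogonal projection onto the orthogonal complement of $V$. The constants $\alpha,\beta_1,\beta_2\in[0,1]$ satisfy, for all $t\in[0,T]$: $\|\Pi_{\partial\mathbf U_{\theta_t}^\perp}\mathbf U_{\theta_t}\|_{\mathbb L^2}\le\alpha\|\mathbf U_{\theta_t}\|_{\mathbb L^2}$; $\ \|\Pi_{\partial\boldsymbol\Phi_{\eta_t,\xi_t}^\perp}(\widetilde{\mathcal L}\oplus\mathrm{Id})\mathbf U_{\theta_t}\|_{\mathbb L^2}\le\beta_1\|(\widetilde{\mathcal L}\oplus\mathrm{Id})\mathbf U_{\theta_t}\|_{\mathbb L^2}$; $\ \|\Pi_{\partial\boldsymbol\Phi_{\eta_t,\xi_t}^\perp}\boldsymbol\Phi_{\eta_t,\xi_t}\|_{\mathbb L^2}\le\beta_2\|\boldsymbol\Phi_{\eta_t,\xi_t}\|_{\mathbb L^2}$. *)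

theory Defs
  imports "HOL-Analysis.Analysis"
begin

section \<open>Lipschitz domains and surface measure\<close>

text \<open>Near each boundary point, after a rotation taking \<open>e\<close> to the last coordinate direction,
  the set is the strict epigraph of a Lipschitz function of the remaining coordinates.\<close>

definition lipschitz_boundary :: "'a::euclidean_space set \<Rightarrow> bool" where
  "lipschitz_boundary \<Omega> \<longleftrightarrow>
     (\<forall>p \<in> frontier \<Omega>. \<exists>e g \<rho> C. norm e = 1 \<and> \<rho> > 0 \<and> C-lipschitz_on {y. y \<bullet> e = 0} g \<and>
        \<Omega> \<inter> ball p \<rho> = {x \<in> ball p \<rho>. g (x - (x \<bullet> e) *\<^sub>R e) < x \<bullet> e})"

text \<open>\<open>k\<close>-dimensional Hausdorff measure, normalised by the volume of the \<open>k\<close>-dimensional unit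
  ball. For \<open>k = 0\<close> every nonempty set of the cover contributes \<open>1\<close>, so that the
  zero-dimensional measure is the counting measure.\<close>

definition hausdorff_size :: "nat \<Rightarrow> 'a::metric_space set \<Rightarrow> ennreal" where
  "hausdorff_size k C =
     (if C = {} then 0 else ennreal (unit_ball_vol (real k) * (diameter C / 2) ^ k))"

definition hausdorff_pre :: "nat \<Rightarrow> real \<Rightarrow> 'a::metric_space set \<Rightarrow> ennreal" where
  "hausdorff_pre k \<delta> A =
     (INF C \<in> {C :: nat \<Rightarrow> 'a set. A \<subseteq> (\<Union>i. C i) \<and> (\<forall>i. bounded (C i) \<and> diameter (C i) \<le> \<delta>)}.
        \<Sum>i. hausdorff_size k (C i))"

definition hausdorff_outer :: "nat \<Rightarrow> 'a::metric_space set \<Rightarrow> ennreal" where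
  "hausdorff_outer k A = (SUP \<delta> \<in> {0<..}. hausdorff_pre k \<delta> A)"

definition hausdorff_measure :: "nat \<Rightarrow> 'a::metric_space measure" where
  "hausdorff_measure k = measure_of UNIV (sets borel) (hausdorff_outer k)"

text \<open>\<^const>\<open>measure_of\<close> yields the zero measure unless the given set function is countably
  additive, so we check that the Hausdorff outer measure is, on Borel sets.\<close>

lemma hausdorff_pre_le:
  "A \<subseteq> (\<Union>i. C i) \<Longrightarrow> (\<And>i. bounded (C i) \<and> diameter (C i) \<le> \<delta>) \<Longrightarrow>
     hausdorff_pre k \<delta> A \<le> (\<Sum>i. hausdorff_size k (C i))"
  unfolding hausdorff_pre_def by (rule INF_lower) auto

lemma hausdorff_pre_close:
  assumes "hausdorff_pre k \<delta> A < e"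
  obtains C :: "nat \<Rightarrow> 'a::metric_space set" where "A \<subseteq> (\<Union>i. C i)" "\<And>i. bounded (C i)"
    "\<And>i. diameter (C i) \<le> \<delta>" "(\<Sum>i. hausdorff_size k (C i)) < e"
  using assms unfolding hausdorff_pre_def INF_less_iff by auto

lemma hausdorff_pre_empty [simp]: "\<delta> \<ge> 0 \<Longrightarrow> hausdorff_pre k \<delta> {} = 0"
  using hausdorff_pre_le[of "{}" "\<lambda>_. {}" \<delta> k] by (simp add: hausdorff_size_def)

lemma hausdorff_pre_mono: "A \<subseteq> B \<Longrightarrow> hausdorff_pre k \<delta> A \<le> hausdorff_pre k \<delta> B"
  unfolding hausdorff_pre_def by (intro INF_superset_mono) auto

lemma hausdorff_pre_antimono: "\<delta> \<le> \<epsilon> \<Longrightarrow> hausdorff_pre k \<epsilon> A \<le> hausdorff_pre k \<delta> A"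
  unfolding hausdorff_pre_def by (intro INF_superset_mono) (auto intro: order_trans)

lemma hausdorff_pre_UN:
  "hausdorff_pre k \<delta> (\<Union>n. A n) \<le> (\<Sum>n. hausdorff_pre k \<delta> (A n))"
proof (rule ennreal_le_epsilon)
  fix e :: real assume e: "0 < e" and fin: "(\<Sum>n. hausdorff_pre k \<delta> (A n)) < top"
  then have *: "\<And>n. hausdorff_pre k \<delta> (A n) < hausdorff_pre k \<delta> (A n) + e * (1/2)^Suc n"
    by (auto simp add: less_top dest!: ennreal_suminf_lessD)
  have "\<exists>C. A n \<subseteq> (\<Union>i. C i) \<and> (\<forall>i. bounded (C i) \<and> diameter (C i) \<le> \<delta>) \<and>
      (\<Sum>i::nat. hausdorff_size k (C i)) \<le> hausdorff_pre k \<delta> (A n) + e * (1/2)^Suc n" for n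
    by (rule hausdorff_pre_close[OF *]) (blast intro: less_imp_le)
  then obtain B where "\<forall>n. A n \<subseteq> (\<Union>i. B n i) \<and> (\<forall>i. bounded (B n i) \<and> diameter (B n i) \<le> \<delta>) \<and>
      (\<Sum>i::nat. hausdorff_size k (B n i)) \<le> hausdorff_pre k \<delta> (A n) + e * (1/2)^Suc n"
    using choice[of "\<lambda>n C. A n \<subseteq> (\<Union>i. C i) \<and> (\<forall>i. bounded (C i) \<and> diameter (C i) \<le> \<delta>) \<and>
      (\<Sum>i::nat. hausdorff_size k (C i)) \<le> hausdorff_pre k \<delta> (A n) + e * (1/2)^Suc n"] by blast
  then have B: "\<And>n. A n \<subseteq> (\<Union>i. B n i)"
    "\<And>n i. bounded (B n i) \<and> diameter (B n i) \<le> \<delta>"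
    "\<And>n. (\<Sum>i::nat. hausdorff_size k (B n i)) \<le> hausdorff_pre k \<delta> (A n) + e * (1/2)^Suc n"
    by blast+
  define C where "C = case_prod B o prod_decode"
  have cover: "(\<Union>i. A i) \<subseteq> (\<Union>i. C i)"
    using B(1) by (auto simp add: C_def subset_eq) (metis prod.case prod_encode_inverse)
  have "hausdorff_pre k \<delta> (\<Union>n. A n) \<le> (\<Sum>i. hausdorff_size k (C i))"
    using B(2) by (intro hausdorff_pre_le cover) (auto simp: C_def split: prod.splits)
  also have "\<dots> = (\<Sum>n. \<Sum>i. hausdorff_size k (B n i))"
    using suminf_ennreal_2dimen[of "\<lambda>n. \<Sum>i. hausdorff_size k (B n i)"
        "\<lambda>(n, i). hausdorff_size k (B n i)"]
    by (simp add: C_def comp_def split_def)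
  also have "\<dots> \<le> (\<Sum>n. hausdorff_pre k \<delta> (A n) + e * (1/2) ^ Suc n)"
    using B(3) by (intro suminf_le) auto
  also have "\<dots> = (\<Sum>n. hausdorff_pre k \<delta> (A n)) + (\<Sum>n. ennreal e * ennreal ((1/2) ^ Suc n))"
    using \<open>0 < e\<close> by (subst suminf_add[symmetric])
                     (auto simp del: ennreal_suminf_cmult simp add: ennreal_mult[symmetric])
  also have "\<dots> = (\<Sum>n. hausdorff_pre k \<delta> (A n)) + e"
    unfolding ennreal_suminf_cmult
    by (subst suminf_ennreal_eq[OF zero_le_power power_half_series]) auto
  finally show "hausdorff_pre k \<delta> (\<Union>n. A n) \<le> (\<Sum>n. hausdorff_pre k \<delta> (A n)) + e" .
qed

lemma hausdorff_outer_mono: "A \<subseteq> B \<Longrightarrow> hausdorff_outer k A \<le> hausdorff_outer k B"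
  unfolding hausdorff_outer_def by (intro SUP_mono) (auto intro: hausdorff_pre_mono)

lemma hausdorff_outer_space: "outer_measure_space (Pow UNIV) (hausdorff_outer k)"
  unfolding outer_measure_space_def positive_def increasing_def countably_subadditive_def
proof (intro conjI ballI allI impI)
  show "hausdorff_outer k {} = 0"
    by (auto simp: hausdorff_outer_def intro!: SUP_eq_const)
next
  fix A B :: "'a set" assume "A \<subseteq> B"
  then show "hausdorff_outer k A \<le> hausdorff_outer k B" by (rule hausdorff_outer_mono)
next
  fix A :: "nat \<Rightarrow> 'a set"
  show "hausdorff_outer k (\<Union>i. A i) \<le> (\<Sum>i. hausdorff_outer k (A i))"
    unfolding hausdorff_outer_def[of k "\<Union>i. A i"]
  proof (rule SUP_least)
    fix \<delta> :: real assume \<delta>: "\<delta> \<in> {0<..}"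
    have "hausdorff_pre k \<delta> (\<Union>i. A i) \<le> (\<Sum>i. hausdorff_pre k \<delta> (A i))"
      by (rule hausdorff_pre_UN)
    also have "\<dots> \<le> (\<Sum>i. hausdorff_outer k (A i))"
      unfolding hausdorff_outer_def using \<delta> by (intro suminf_le SUP_upper) auto
    finally show "hausdorff_pre k \<delta> (\<Union>i. A i) \<le> (\<Sum>i. hausdorff_outer k (A i))" .
  qed
qed

lemma hausdorff_pre_separated:
  assumes sep: "\<And>x y. x \<in> A \<Longrightarrow> y \<in> B \<Longrightarrow> \<delta> < dist x y" and "0 \<le> \<delta>"
  shows "hausdorff_pre k \<delta> A + hausdorff_pre k \<delta> B \<le> hausdorff_pre k \<delta> (A \<union> B)"
  unfolding hausdorff_pre_def[of k \<delta> "A \<union> B"]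
proof (rule INF_greatest)
  fix C :: "nat \<Rightarrow> 'a set"
  assume "C \<in> {C. A \<union> B \<subseteq> (\<Union>i. C i) \<and> (\<forall>i. bounded (C i) \<and> diameter (C i) \<le> \<delta>)}"
  then have C: "A \<union> B \<subseteq> (\<Union>i. C i)" "\<And>i. bounded (C i)" "\<And>i. diameter (C i) \<le> \<delta>" by auto
  define D where "D X i = (if C i \<inter> X = {} then {} else C i)" for X i
  have D: "X \<subseteq> (\<Union>i. D X i)" if "X \<subseteq> A \<union> B" for X
    using C(1) that by (fastforce simp: D_def)
  have Db: "bounded (D X i) \<and> diameter (D X i) \<le> \<delta>" for X i
    using C \<open>0 \<le> \<delta>\<close> by (auto simp: D_def)
  have le: "hausdorff_size k (D A i) + hausdorff_size k (D B i) \<le> hausdorff_size k (C i)" for i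
  proof -
    have "C i \<inter> A = {} \<or> C i \<inter> B = {}"
    proof (rule ccontr)
      assume "\<not> (C i \<inter> A = {} \<or> C i \<inter> B = {})"
      then obtain x y where "x \<in> A" "y \<in> B" "x \<in> C i" "y \<in> C i" by auto
      then show False
        using sep[of x y] diameter_bounded_bound[OF C(2), of x i y] C(3)[of i] by auto
    qed
    then show ?thesis by (auto simp: D_def hausdorff_size_def)
  qed
  have "hausdorff_pre k \<delta> A + hausdorff_pre k \<delta> B
      \<le> (\<Sum>i. hausdorff_size k (D A i)) + (\<Sum>i. hausdorff_size k (D B i))"
    by (intro add_mono hausdorff_pre_le D Db) auto
  also have "\<dots> = (\<Sum>i. hausdorff_size k (D A i) + hausdorff_size k (D B i))"
    by (rule suminf_add) auto
  also have "\<dots> \<le> (\<Sum>i. hausdorff_size k (C i))"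
    using le by (intro suminf_le) auto
  finally show "hausdorff_pre k \<delta> A + hausdorff_pre k \<delta> B \<le> (\<Sum>i. hausdorff_size k (C i))" .
qed

lemma hausdorff_outer_separated:
  assumes sep: "\<And>x y. x \<in> A \<Longrightarrow> y \<in> B \<Longrightarrow> \<epsilon> \<le> dist x y" and "0 < \<epsilon>"
  shows "hausdorff_outer k A + hausdorff_outer k B \<le> hausdorff_outer k (A \<union> B)"
proof -
  have "hausdorff_outer k A + hausdorff_outer k B
      = (SUP \<delta>\<in>{0<..}. hausdorff_pre k \<delta> A + hausdorff_pre k \<delta> B)"
    unfolding hausdorff_outer_def
  proof (rule SUP_add_directed_ennreal[symmetric])
    fix i j :: real assume "i \<in> {0<..}" "j \<in> {0<..}"
    then show "\<exists>l\<in>{0<..}. hausdorff_pre k i A + hausdorff_pre k j B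
        \<le> hausdorff_pre k l A + hausdorff_pre k l B"
      by (intro bexI[of _ "min i j"] add_mono hausdorff_pre_antimono) auto
  qed
  also have "\<dots> \<le> hausdorff_outer k (A \<union> B)"
  proof (rule SUP_least)
    fix \<delta> :: real assume \<delta>: "\<delta> \<in> {0<..}"
    define d where "d = min \<delta> (\<epsilon> / 2)"
    have d: "0 < d" "d \<le> \<delta>" "d < \<epsilon>" using \<delta> \<open>0 < \<epsilon>\<close> by (auto simp: d_def)
    have "hausdorff_pre k \<delta> A + hausdorff_pre k \<delta> B \<le> hausdorff_pre k d A + hausdorff_pre k d B"
      using d by (intro add_mono hausdorff_pre_antimono)
    also have "\<dots> \<le> hausdorff_pre k d (A \<union> B)"
      using d sep by (intro hausdorff_pre_separated) (auto intro: less_le_trans)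
    also have "\<dots> \<le> hausdorff_outer k (A \<union> B)"
      unfolding hausdorff_outer_def using d by (intro SUP_upper) auto
    finally show "hausdorff_pre k \<delta> A + hausdorff_pre k \<delta> B \<le> hausdorff_outer k (A \<union> B)" .
  qed
  finally show ?thesis .
qed

lemma separated_strips:
  fixes F :: "'a::metric_space set"
  assumes le: "\<And>m. R m \<subseteq> {x. 1 / (real m + 2) \<le> infdist x F \<and> infdist x F < 1 / (real m + 1)}"
    and sub: "\<And>m. R m \<subseteq> A"
  shows "(\<Sum>m<N. hausdorff_outer k (R (2 * m + j))) \<le> hausdorff_outer k A"
proof -
  have "(\<Sum>m<N. hausdorff_outer k (R (2 * m + j))) \<le> hausdorff_outer k (\<Union>m<N. R (2 * m + j))"
  proof (induction N)
    case (Suc N)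
    have "(\<Sum>m<Suc N. hausdorff_outer k (R (2 * m + j)))
        \<le> hausdorff_outer k (\<Union>m<N. R (2 * m + j)) + hausdorff_outer k (R (2 * N + j))"
      using Suc by (auto intro: add_right_mono)
    also have "\<dots> \<le> hausdorff_outer k ((\<Union>m<N. R (2 * m + j)) \<union> R (2 * N + j))"
    proof (cases "N = 0")
      case True
      then show ?thesis
        using hausdorff_outer_space[of k, where 'a = 'a]
        by (simp add: outer_measure_space_def positive_def)
    next
      case False
      let ?a = "1 / (real (2 * N + j))" and ?b = "1 / (real (2 * N + j) + 1)"
      show ?thesis
      proof (rule hausdorff_outer_separated)
        show "0 < ?a - ?b" using False by (simp add: divide_strict_left_mono)
        fix x y assume "x \<in> (\<Union>m<N. R (2 * m + j))" and y: "y \<in> R (2 * N + j)"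
        then obtain m where m: "m < N" "x \<in> R (2 * m + j)" by auto
        have "?a \<le> 1 / (real (2 * m + j) + 2)" using m by (intro divide_left_mono) auto
        also have "\<dots> \<le> infdist x F" using le[of "2 * m + j"] m by auto
        also have "\<dots> \<le> infdist y F + dist x y" by (rule infdist_triangle)
        also have "\<dots> \<le> ?b + dist x y" using le[of "2 * N + j"] y by auto
        finally show "?a - ?b \<le> dist x y" by simp
      qed
    qed
    also have "(\<Union>m<N. R (2 * m + j)) \<union> R (2 * N + j) = (\<Union>m<Suc N. R (2 * m + j))"
      by (auto simp: less_Suc_eq)
    finally show ?case .
  qed simp
  also have "\<dots> \<le> hausdorff_outer k A" using sub by (intro hausdorff_outer_mono) auto
  finally show ?thesis .
qed

lemma sum_even_odd: "(\<Sum>m<2 * N. g m) = (\<Sum>m<N. g (2 * m)) + (\<Sum>m<N. g (2 * m + 1))"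
  for g :: "nat \<Rightarrow> 'a::comm_monoid_add"
  by (induction N) (auto simp: ac_simps)

lemma closed_lambda_system_hausdorff:
  fixes F :: "'a::metric_space set"
  assumes "closed F"
  shows "F \<in> lambda_system UNIV (Pow UNIV) (hausdorff_outer k)"
proof -
  let ?\<mu> = "hausdorff_outer k :: 'a set \<Rightarrow> ennreal"
  have oms: "positive (Pow UNIV) ?\<mu>" "countably_subadditive (Pow UNIV) ?\<mu>"
    using hausdorff_outer_space[of k, where 'a = 'a] unfolding outer_measure_space_def by blast+
  have sub2: "?\<mu> (A \<union> B) \<le> ?\<mu> A + ?\<mu> B" for A B :: "'a set"
  proof -
    have "subadditive (Pow UNIV) ?\<mu>"
      using ring_of_sets.countably_subadditive_subadditive[OF algebra.axioms(1)[OF algebra_Pow] oms] .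
    then have "?\<mu> (A \<union> (B - A)) \<le> ?\<mu> A + ?\<mu> (B - A)"
      by (rule subadditiveD) auto
    then have "?\<mu> (A \<union> B) \<le> ?\<mu> A + ?\<mu> (B - A)" by simp
    also have "\<dots> \<le> ?\<mu> A + ?\<mu> B" by (intro add_left_mono hausdorff_outer_mono) auto
    finally show ?thesis .
  qed
  have subN: "?\<mu> (\<Union>i. A i) \<le> (\<Sum>i. ?\<mu> (A i))" for A :: "nat \<Rightarrow> 'a set"
  proof -
    have "?\<mu> (\<Union>i. A i) = ?\<mu> (\<Union>i. disjointed A i)" by (simp add: UN_disjointed_eq)
    also have "\<dots> \<le> (\<Sum>i. ?\<mu> (disjointed A i))"
      using oms(2) unfolding countably_subadditive_def
      by (simp add: disjoint_family_disjointed)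
    also have "\<dots> \<le> (\<Sum>i. ?\<mu> (A i))"
      by (intro suminf_le hausdorff_outer_mono disjointed_subset) auto
    finally show ?thesis .
  qed
  have "?\<mu> (A \<inter> F) + ?\<mu> (A - F) \<le> ?\<mu> A" for A
  proof (cases "F = {} \<or> ?\<mu> A = \<infinity>")
    case True
    then show ?thesis using oms(1) by (auto simp: positive_def)
  next
    case False
    then have "F \<noteq> {}" and fin: "?\<mu> A \<noteq> \<infinity>" by auto
    define S where "S n = {x \<in> A. 1 / (real n + 1) \<le> infdist x F}" for n :: nat
    define R where "R m = {x \<in> A. 1 / (real m + 2) \<le> infdist x F \<and> infdist x F < 1 / (real m + 1)}"
      for m :: nat
    have S: "?\<mu> (A \<inter> F) + ?\<mu> (S n) \<le> ?\<mu> A" for n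
    proof -
      have "?\<mu> (A \<inter> F) + ?\<mu> (S n) \<le> ?\<mu> ((A \<inter> F) \<union> S n)"
      proof (rule hausdorff_outer_separated)
        fix x y assume "x \<in> A \<inter> F" "y \<in> S n"
        then show "1 / (real n + 1) \<le> dist x y"
          using infdist_le[of x F y] by (auto simp: S_def dist_commute)
      qed simp
      also have "\<dots> \<le> ?\<mu> A" by (rule hausdorff_outer_mono) (auto simp: S_def)
      finally show ?thesis .
    qed
    have "(\<Sum>m<N. ?\<mu> (R m)) \<le> 2 * ?\<mu> A" for N
    proof -
      have "(\<Sum>m<N. ?\<mu> (R m)) \<le> (\<Sum>m<2 * N. ?\<mu> (R m))"
        by (intro sum_mono2) auto
      also have "\<dots> = (\<Sum>m<N. ?\<mu> (R (2 * m + 0))) + (\<Sum>m<N. ?\<mu> (R (2 * m + 1)))"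
        by (simp add: sum_even_odd)
      also have "\<dots> \<le> ?\<mu> A + ?\<mu> A"
        by (intro add_mono separated_strips[where F = F]) (auto simp: R_def)
      finally show ?thesis by (simp add: mult_2)
    qed
    then have "(\<Sum>m. ?\<mu> (R m)) \<le> 2 * ?\<mu> A" by (intro suminf_le_const) auto
    also have "\<dots> < \<infinity>" using fin by (auto simp: ennreal_mult_less_top less_top)
    finally have finR: "(\<Sum>m. ?\<mu> (R m)) \<noteq> top" by auto
    have tail: "(\<lambda>n. \<Sum>m. ?\<mu> (R (m + n))) \<longlonglongrightarrow> 0"
    proof -
      define a where "a m = enn2real (?\<mu> (R m))" for m
      have a: "?\<mu> (R m) = ennreal (a m)" "0 \<le> a m" for m
        using ennreal_suminf_lessD[of "\<lambda>m. ?\<mu> (R m)" top m] finR by (auto simp: a_def less_top)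
      have sa: "summable a" using finR a by (auto intro!: summable_suminf_not_top)
      have "(\<lambda>n. ennreal (\<Sum>m. a (m + n))) \<longlonglongrightarrow> ennreal 0"
        by (intro tendsto_ennrealI suminf_exist_split2 sa)
      moreover have "ennreal (\<Sum>m. a (m + n)) = (\<Sum>m. ?\<mu> (R (m + n)))" for n
        using sa a by (auto simp: suminf_ennreal2 summable_iff_shift)
      ultimately show ?thesis by simp
    qed
    have bound: "?\<mu> (A \<inter> F) + ?\<mu> (A - F) \<le> ?\<mu> A + (\<Sum>m. ?\<mu> (R (m + n)))" for n
    proof -
      have "A - F \<subseteq> S n \<union> (\<Union>m. R (m + n))"
      proof
        fix x assume x: "x \<in> A - F"
        then have pos: "0 < infdist x F"
          using infdist_pos_not_in_closed \<open>closed F\<close> \<open>F \<noteq> {}\<close> by blast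
        show "x \<in> S n \<union> (\<Union>m. R (m + n))"
        proof (cases "1 / (real n + 1) \<le> infdist x F")
          case False
          have ex: "\<exists>m. 1 / (real m + 1) \<le> infdist x F"
            using reals_Archimedean[OF pos] by (auto simp: field_simps intro: less_imp_le)
          define l where "l = (LEAST m. 1 / (real m + 1) \<le> infdist x F)"
          have l: "1 / (real l + 1) \<le> infdist x F" unfolding l_def using ex by (rule LeastI_ex)
          have "n < l"
          proof (rule ccontr)
            assume "\<not> n < l"
            then have "1 / (real n + 1) \<le> 1 / (real l + 1)" by (intro divide_left_mono) auto
            then show False using l False by simp
          qed
          then obtain m where m: "l = Suc (m + n)" by (metis add.commute less_imp_Suc_add)
          have "\<not> 1 / (real (m + n) + 1) \<le> infdist x F"
            using not_less_Least[of "m + n" "\<lambda>m. 1 / (real m + 1) \<le> infdist x F"] m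
            unfolding l_def by auto
          then have "x \<in> R (m + n)" using l m x by (auto simp: R_def add.commute)
          then show ?thesis by auto
        qed (use x in \<open>auto simp: S_def\<close>)
      qed
      then have "?\<mu> (A - F) \<le> ?\<mu> (S n \<union> (\<Union>m. R (m + n)))" by (rule hausdorff_outer_mono)
      also have "\<dots> \<le> ?\<mu> (S n) + ?\<mu> (\<Union>m. R (m + n))" by (rule sub2)
      also have "\<dots> \<le> ?\<mu> (S n) + (\<Sum>m. ?\<mu> (R (m + n)))"
        by (intro add_left_mono subN)
      finally have "?\<mu> (A \<inter> F) + ?\<mu> (A - F)
          \<le> (?\<mu> (A \<inter> F) + ?\<mu> (S n)) + (\<Sum>m. ?\<mu> (R (m + n)))"
        by (simp add: add.assoc add_left_mono)
      also have "\<dots> \<le> ?\<mu> A + (\<Sum>m. ?\<mu> (R (m + n)))"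
        by (intro add_right_mono S)
      finally show ?thesis .
    qed
    have "(\<lambda>n. ?\<mu> A + (\<Sum>m. ?\<mu> (R (m + n)))) \<longlonglongrightarrow> ?\<mu> A + 0"
      by (intro tendsto_add tendsto_const tail)
    then show ?thesis
      using LIMSEQ_le_const[of _ "?\<mu> A" "?\<mu> (A \<inter> F) + ?\<mu> (A - F)"] bound by auto
  qed
  moreover have "?\<mu> A \<le> ?\<mu> (A \<inter> F) + ?\<mu> (A - F)" for A
    using sub2[of "A \<inter> F" "A - F"] by (simp add: Int_Diff_Un)
  ultimately show ?thesis
    unfolding algebra.lambda_system_eq[OF algebra_Pow] by (auto intro: antisym)
qed

lemma measure_space_hausdorff:
  "measure_space UNIV (sets (borel :: 'a::metric_space measure)) (hausdorff_outer k)"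
proof -
  let ?L = "lambda_system UNIV (Pow UNIV) (hausdorff_outer k) :: 'a set set"
  have ms: "measure_space UNIV ?L (hausdorff_outer k)"
    by (intro sigma_algebra.caratheodory_lemma sigma_algebra_Pow hausdorff_outer_space)
  then interpret sigma_algebra UNIV ?L by (simp add: measure_space_def)
  have "sets (borel :: 'a measure) = sigma_sets UNIV (Collect closed)"
    by (simp add: borel_eq_closed)
  also have "\<dots> \<subseteq> ?L"
    using closed_lambda_system_hausdorff by (intro sigma_sets_subset) blast
  finally show ?thesis
    using sets.sigma_algebra_axioms[of "borel :: 'a measure"] measure_down[OF ms] by auto
qed

lemma emeasure_hausdorff_measure:
  assumes "A \<in> sets borel"
  shows "emeasure (hausdorff_measure k) A = hausdorff_outer k A"
  using assms measure_space_hausdorff[of k, where 'a = 'a]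
  unfolding hausdorff_measure_def
  by (intro emeasure_measure_of_sigma) (auto simp: measure_space_def)

definition surface_measure :: "'a::euclidean_space set \<Rightarrow> 'a measure" where
  "surface_measure \<Omega> = restrict_space (hausdorff_measure (DIM('a) - 1)) (frontier \<Omega>)"

section \<open>Function spaces\<close>

text \<open>\<open>l2_space M rep\<close> says that the inner product space \<open>'v\<close> is the space of square integrable
  functions with respect to \<open>M\<close> modulo \<open>M\<close>-null functions, \<open>rep\<close> choosing for each element of
  \<open>'v\<close> a function in its class. (A type for each \<open>L\<^sup>2(\<Omega>)\<close> cannot be formed, since it would
  depend on the term \<open>\<Omega>\<close>.)\<close>

definition square_integrable :: "'a measure \<Rightarrow> ('a \<Rightarrow> 'b::euclidean_space) \<Rightarrow> bool" where
  "square_integrable M f \<longleftrightarrow> f \<in> borel_measurable M \<and> integrable M (\<lambda>x. (norm (f x))\<^sup>2)"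

definition l2_space :: "'a measure \<Rightarrow> ('v::real_inner \<Rightarrow> 'a \<Rightarrow> 'b::euclidean_space) \<Rightarrow> bool" where
  "l2_space M rep \<longleftrightarrow>
     (\<forall>v. square_integrable M (rep v)) \<and>
     (\<forall>f. square_integrable M f \<longrightarrow> (\<exists>v. AE x in M. rep v x = f x)) \<and>
     (\<forall>v w. AE x in M. rep (v + w) x = rep v x + rep w x) \<and>
     (\<forall>c v. AE x in M. rep (c *\<^sub>R v) x = c *\<^sub>R rep v x) \<and>
     (\<forall>v w. v \<bullet> w = (\<integral>x. rep v x \<bullet> rep w x \<partial>M))"

text \<open>\<open>'h\<close> is a space of functions on \<open>\<Omega>\<close> with pointwise operations. A space of classes modulo
  null functions is of this kind as well: choose representatives linearly.\<close>

definition function_space_on :: "'a set \<Rightarrow> ('h::real_vector \<Rightarrow> 'a \<Rightarrow> real) \<Rightarrow> bool" where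
  "function_space_on \<Omega> val \<longleftrightarrow>
     (\<forall>u v. \<forall>x\<in>\<Omega>. val (u + v) x = val u x + val v x) \<and>
     (\<forall>c u. \<forall>x\<in>\<Omega>. val (c *\<^sub>R u) x = c * val u x) \<and>
     (\<forall>u. (\<forall>x\<in>\<Omega>. val u x = 0) \<longrightarrow> u = 0)"

text \<open>A linear subspace that is a Hilbert space for its own inner product \<open>ip\<close>, which need not
  be the restriction of the ambient one.\<close>

definition hilbert_subspace :: "'a::real_vector set \<Rightarrow> ('a \<Rightarrow> 'a \<Rightarrow> real) \<Rightarrow> bool" where
  "hilbert_subspace S ip \<longleftrightarrow> subspace S \<and>
     (\<forall>x\<in>S. \<forall>y\<in>S. ip x y = ip y x) \<and>
     (\<forall>x\<in>S. \<forall>y\<in>S. \<forall>z\<in>S. ip (x + y) z = ip x z + ip y z) \<and>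
     (\<forall>c. \<forall>x\<in>S. \<forall>y\<in>S. ip (c *\<^sub>R x) y = c * ip x y) \<and>
     (\<forall>x\<in>S. 0 \<le> ip x x \<and> (ip x x = 0 \<longrightarrow> x = 0)) \<and>
     (\<forall>\<sigma>. range \<sigma> \<subseteq> S \<and> (\<forall>\<epsilon>>0. \<exists>N. \<forall>m\<ge>N. \<forall>n\<ge>N. sqrt (ip (\<sigma> m - \<sigma> n) (\<sigma> m - \<sigma> n)) < \<epsilon>) \<longrightarrow>
        (\<exists>x\<in>S. (\<lambda>n. sqrt (ip (\<sigma> n - x) (\<sigma> n - x))) \<longlonglongrightarrow> 0))"

definition linear_op_on :: "'a::real_vector set \<Rightarrow> 'b::real_vector set \<Rightarrow> ('a \<Rightarrow> 'b) \<Rightarrow> bool" where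
  "linear_op_on S T A \<longleftrightarrow>
     A ` S \<subseteq> T \<and>
     (\<forall>x\<in>S. \<forall>y\<in>S. A (x + y) = A x + A y) \<and>
     (\<forall>c. \<forall>x\<in>S. A (c *\<^sub>R x) = c *\<^sub>R A x)"

section \<open>Derivatives, projections and pseudoinverses\<close>

definition partial_deriv :: "(real^'n \<Rightarrow> 'a::real_normed_vector) \<Rightarrow> 'n \<Rightarrow> real^'n \<Rightarrow> 'a" where
  "partial_deriv F k x = frechet_derivative F (at x) (axis k 1)"

definition grad :: "('a::real_inner \<Rightarrow> real) \<Rightarrow> 'a \<Rightarrow> 'a" where
  "grad F x = (THE D. GDERIV F x :> D)"

definition orth_proj :: "'a::real_inner set \<Rightarrow> 'a \<Rightarrow> 'a" where
  "orth_proj V x = (THE p. p \<in> V \<and> x - p \<in> V\<^sup>\<bottom>)"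

definition moore_penrose :: "real^'n^'m \<Rightarrow> real^'m^'n \<Rightarrow> bool" where
  "moore_penrose A X \<longleftrightarrow> A ** X ** A = A \<and> X ** A ** X = X \<and>
     transpose (A ** X) = A ** X \<and> transpose (X ** A) = X ** A"

definition pinv :: "real^'n^'m \<Rightarrow> real^'m^'n" where
  "pinv A = (THE X. moore_penrose A X)"

lemma orth_proj_eq:
  assumes "subspace V" "p \<in> V" "x - p \<in> V\<^sup>\<bottom>"
  shows "orth_proj V x = p"
  unfolding orth_proj_def
proof (rule the_equality)
  fix q assume q: "q \<in> V \<and> x - q \<in> V\<^sup>\<bottom>"
  have "p - q \<in> V" using assms q by (auto intro: subspace_diff)
  then have "(p - q) \<bullet> (x - q) = 0" "(p - q) \<bullet> (x - p) = 0"
    using assms q by (auto simp: orthogonal_comp_def orthogonal_def)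
  then have "(p - q) \<bullet> (p - q) = 0" by (simp add: inner_diff_right)
  then show "q = p" by simp
qed (use assms in auto)

lemma moore_penrose_unique:
  assumes "moore_penrose A X" "moore_penrose A Y"
  shows "X = Y"
proof -
  have X: "A ** X ** A = A" "X ** A ** X = X" "transpose (A ** X) = A ** X" "transpose (X ** A) = X ** A"
   and Y: "A ** Y ** A = A" "Y ** A ** Y = Y" "transpose (A ** Y) = A ** Y" "transpose (Y ** A) = Y ** A"
    using assms by (auto simp: moore_penrose_def)
  have "A ** X = transpose (A ** X)" using X by simp
  also have "\<dots> = transpose (A ** Y ** (A ** X))" using Y by (simp add: matrix_mul_assoc)
  also have "\<dots> = A ** X ** (A ** Y)" using X Y by (simp add: matrix_transpose_mul)
  also have "\<dots> = A ** Y" using X by (simp add: matrix_mul_assoc)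
  finally have 1: "A ** X = A ** Y" .
  have "X ** A = transpose (X ** A)" using X by simp
  also have "\<dots> = transpose (X ** A ** (Y ** A))" using Y(1) by (simp add: matrix_mul_assoc[symmetric])
  also have "\<dots> = Y ** A ** (X ** A)" using X Y by (simp add: matrix_transpose_mul)
  also have "\<dots> = Y ** A" using X(1) by (simp add: matrix_mul_assoc[symmetric])
  finally have 2: "X ** A = Y ** A" .
  have "X = Y ** A ** X" using X(2) 2 by simp
  also have "\<dots> = Y ** (A ** X)" by (simp add: matrix_mul_assoc)
  also have "\<dots> = Y ** A ** Y" using 1 by (simp add: matrix_mul_assoc)
  finally show ?thesis using Y(2) by simp
qed

lemma moore_penrose_exists:
  fixes A :: "real^'n^'m"
  shows "\<exists>X. moore_penrose A X"
proof -
  define P where "P y x \<longleftrightarrow> (\<forall>n. A *v n = 0 \<longrightarrow> x \<bullet> n = 0) \<and> (\<forall>v. (y - A *v x) \<bullet> (A *v v) = 0)" for y x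
  have ex: "\<exists>x. P y x" for y
  proof -
    have "subspace (range ((*v) A))" by (intro linear_subspace_image) auto
    then have spR: "span (range ((*v) A)) = range ((*v) A)" by (rule span_eq_iff[THEN iffD2])
    obtain a b where ab: "a \<in> span (range ((*v) A))"
      "\<And>w. w \<in> span (range ((*v) A)) \<Longrightarrow> orthogonal b w" "y = a + b"
      using orthogonal_subspace_decomp_exists by blast
    then obtain x0 where x0: "a = A *v x0" using spR by auto
    have "subspace {n. A *v n = 0}"
      by (simp add: subspace_def matrix_vector_right_distrib matrix_vector_mult_scaleR)
    then have spN: "span {n. A *v n = 0} = {n. A *v n = 0}" by (rule span_eq_iff[THEN iffD2])
    obtain n x where nx: "n \<in> span {n. A *v n = 0}"
      "\<And>w. w \<in> span {n. A *v n = 0} \<Longrightarrow> orthogonal x w" "x0 = n + x"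
      using orthogonal_subspace_decomp_exists by blast
    have "A *v x = a" using nx x0 spN by (simp add: matrix_vector_right_distrib)
    then have "P y x" using nx(2) spN ab spR by (auto simp: P_def orthogonal_def)
    then show ?thesis ..
  qed
  have uniq: "x = x'" if "P y x" "P y x'" for y x x'
  proof -
    have "(y - A *v x) \<bullet> (A *v (x - x')) - (y - A *v x') \<bullet> (A *v (x - x')) = 0"
      using that by (simp add: P_def)
    moreover have "(y - A *v x) \<bullet> w - (y - A *v x') \<bullet> w = - ((A *v (x - x')) \<bullet> w)" for w
      by (simp add: matrix_vector_mult_diff_distrib inner_diff_left)
    ultimately have "(A *v (x - x')) \<bullet> (A *v (x - x')) = 0" by simp
    then have "A *v (x - x') = 0" by simp
    then have "x \<bullet> (x - x') = 0" "x' \<bullet> (x - x') = 0" using that by (auto simp: P_def)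
    then have "(x - x') \<bullet> (x - x') = 0" by (simp add: inner_diff_left)
    then show ?thesis by simp
  qed
  define h where "h y = (SOME x. P y x)" for y
  have h: "P y (h y)" for y unfolding h_def using ex by (rule someI_ex)
  have hI: "h y = x" if "P y x" for x y using uniq h that by blast
  have "linear h"
  proof (rule linearI)
    fix y z c
    show "h (y + z) = h y + h z"
      using h[of y] h[of z]
      by (intro hI) (auto simp: P_def matrix_vector_right_distrib inner_add_left inner_diff_left)
    show "h (c *\<^sub>R y) = c *\<^sub>R h y"
      using h[of y]
      by (intro hI) (auto simp: P_def matrix_vector_mult_scaleR inner_diff_left)
  qed
  then have X: "matrix h *v y = h y" for y by (simp add: matrix_works)
  have AhA: "A *v h (A *v v) = A *v v" for v
  proof -
    have "(A *v v - A *v h (A *v v)) \<bullet> (A *v (v - h (A *v v))) = 0"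
      using h[of "A *v v"] by (simp add: P_def)
    then show ?thesis by (simp add: matrix_vector_mult_diff_distrib)
  qed
  have hAh: "h (A *v h y) = h y" for y
    using h[of y] by (intro hI) (auto simp: P_def)
  have s1: "(A *v h y) \<bullet> z = y \<bullet> (A *v h z)" for y z
  proof -
    have "(z - A *v h z) \<bullet> (A *v h y) = 0" "(y - A *v h y) \<bullet> (A *v h z) = 0"
      using h by (auto simp: P_def)
    then have "z \<bullet> (A *v h y) = (A *v h z) \<bullet> (A *v h y)"
      and "y \<bullet> (A *v h z) = (A *v h y) \<bullet> (A *v h z)"
      by (simp_all add: inner_diff_left)
    then show ?thesis by (metis inner_commute)
  qed
  have s2: "h (A *v v) \<bullet> w = v \<bullet> h (A *v w)" for v w
  proof -
    have "A *v (w - h (A *v w)) = 0" "A *v (v - h (A *v v)) = 0"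
      by (simp_all add: matrix_vector_mult_diff_distrib AhA)
    then have "h (A *v v) \<bullet> (w - h (A *v w)) = 0" "h (A *v w) \<bullet> (v - h (A *v v)) = 0"
      using h by (auto simp: P_def)
    then have "h (A *v v) \<bullet> w = h (A *v v) \<bullet> h (A *v w)"
      and "h (A *v w) \<bullet> v = h (A *v w) \<bullet> h (A *v v)"
      by (simp_all add: inner_diff_right)
    then show ?thesis by (metis inner_commute)
  qed
  have sym: "transpose M = M" if "\<And>x y. (M *v x) \<bullet> y = x \<bullet> (M *v y)" for M :: "real^'k^'k"
  proof -
    have "x \<bullet> (transpose M *v y) = x \<bullet> (M *v y)" for x y
      using that[of x y] dot_lmul_matrix[of x "transpose M" y] by (simp add: vector_transpose_matrix)
    then have "transpose M *v y = M *v y" for y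
      using vector_eq_ldot[of "transpose M *v y" "M *v y"] by blast
    then show ?thesis by (simp add: matrix_eq)
  qed
  have "moore_penrose A (matrix h)"
    unfolding moore_penrose_def
    using sym[of "A ** matrix h"] sym[of "matrix h ** A"]
    by (auto simp: matrix_eq matrix_vector_mul_assoc[symmetric] X AhA hAh s1 s2)
  then show ?thesis ..
qed

lemma moore_penrose_pinv: "moore_penrose A (pinv A)"
  unfolding pinv_def
  by (rule theI') (use moore_penrose_exists[of A] moore_penrose_unique in blast)

section \<open>The natural primal-dual gradient flow\<close>

text \<open>Naming: \<open>Lt\<close> is the operator with bounds \<open>L0\<close> and \<open>L1\<close> in the splitting
  \<open>L = Mds \<circ> Lt \<circ> Mp\<close>, \<open>Md\<close> is the operator on test functions to which \<open>Mds\<close> is adjoint, and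
  \<open>B\<close> is the boundary operator. The families \<open>u\<close>, \<open>\<phi>\<close>, \<open>\<psi>\<close> are functions of the parameters.\<close>

definition npdg_functional ::
  "('v::real_inner \<Rightarrow> 'v) \<Rightarrow> ('h \<Rightarrow> 'v) \<Rightarrow> ('l::real_inner \<Rightarrow> 'v) \<Rightarrow> ('h \<Rightarrow> 'b::real_inner) \<Rightarrow>
   'l \<Rightarrow> 'b \<Rightarrow> real \<Rightarrow> real \<Rightarrow> 'h \<Rightarrow> 'l \<Rightarrow> 'b \<Rightarrow> real" where
  "npdg_functional Lt Mp Md B f g \<nu> lam u \<phi> \<psi> =
     Lt (Mp u) \<bullet> Md \<phi> - f \<bullet> \<phi> + lam * ((B u - g) \<bullet> \<psi>)
       - \<nu> / 2 * ((norm (Md \<phi>))\<^sup>2 + lam * (norm \<psi>)\<^sup>2)"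

definition gram_primal ::
  "('h \<Rightarrow> 'v::real_inner) \<Rightarrow> ('h \<Rightarrow> 'b::real_inner) \<Rightarrow> real \<Rightarrow> (real^'p \<Rightarrow> 'h) \<Rightarrow> real^'p \<Rightarrow> real^'p^'p" where
  "gram_primal Mp B lam u \<theta> = (\<chi> i j.
     partial_deriv (\<lambda>\<theta>. Mp (u \<theta>)) i \<theta> \<bullet> partial_deriv (\<lambda>\<theta>. Mp (u \<theta>)) j \<theta> +
     lam * (partial_deriv (\<lambda>\<theta>. B (u \<theta>)) i \<theta> \<bullet> partial_deriv (\<lambda>\<theta>. B (u \<theta>)) j \<theta>))"

definition gram_dual ::
  "('l \<Rightarrow> 'v::real_inner) \<Rightarrow> (real^'m \<Rightarrow> 'l) \<Rightarrow> real^'m \<Rightarrow> real^'m^'m" where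
  "gram_dual Md \<phi> \<eta> = (\<chi> i j.
     partial_deriv (\<lambda>\<eta>. Md (\<phi> \<eta>)) i \<eta> \<bullet> partial_deriv (\<lambda>\<eta>. Md (\<phi> \<eta>)) j \<eta>)"

definition gram_bdd ::
  "real \<Rightarrow> (real^'x \<Rightarrow> 'b::real_inner) \<Rightarrow> real^'x \<Rightarrow> real^'x^'x" where
  "gram_bdd lam \<psi> \<xi> = (\<chi> i j. lam * (partial_deriv \<psi> i \<xi> \<bullet> partial_deriv \<psi> j \<xi>))"

text \<open>The extrapolated test function \<open>\<phi> (\<eta> t) + \<gamma> d/dt \<phi> (\<eta> t)\<close> is an admissible argument of
  the functional only if \<open>t \<mapsto> \<phi> (\<eta> t)\<close> has an \<open>L\<^sup>2\<close>-derivative lying in the domain \<open>Kt\<close> of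
  \<open>Md\<close>, so this is part of being a solution. For \<open>\<psi>\<close> it follows from differentiability of \<open>\<psi>\<close>
  and \<open>\<xi>\<close>.\<close>

definition npdg_flow ::
  "('h \<Rightarrow> 'l::real_inner \<Rightarrow> 'b::real_inner \<Rightarrow> real) \<Rightarrow> ('h \<Rightarrow> 'v::real_inner) \<Rightarrow> ('l \<Rightarrow> 'v) \<Rightarrow>
   ('h \<Rightarrow> 'b) \<Rightarrow> 'l set \<Rightarrow> real \<Rightarrow> real \<Rightarrow>
   (real^'p) set \<Rightarrow> (real^'m) set \<Rightarrow> (real^'x) set \<Rightarrow>
   (real^'p \<Rightarrow> 'h) \<Rightarrow> (real^'m \<Rightarrow> 'l) \<Rightarrow> (real^'x \<Rightarrow> 'b) \<Rightarrow> real \<Rightarrow>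
   (real \<Rightarrow> real^'p) \<Rightarrow> (real \<Rightarrow> real^'m) \<Rightarrow> (real \<Rightarrow> real^'x) \<Rightarrow> bool" where
  "npdg_flow E Mp Md B Kt \<gamma> lam \<Theta> H \<Xi> u \<phi> \<psi> T \<theta> \<eta> \<xi> \<longleftrightarrow>
     (\<forall>t\<in>{0..T}.
        \<theta> t \<in> \<Theta> \<and> \<eta> t \<in> H \<and> \<xi> t \<in> \<Xi> \<and>
        (\<eta> has_vector_derivative
           pinv (gram_dual Md \<phi> (\<eta> t)) *v grad (\<lambda>e. E (u (\<theta> t)) (\<phi> e) (\<psi> (\<xi> t))) (\<eta> t))
          (at t within {0..T}) \<and>
        (\<xi> has_vector_derivative
           pinv (gram_bdd lam \<psi> (\<xi> t)) *v grad (\<lambda>x. E (u (\<theta> t)) (\<phi> (\<eta> t)) (\<psi> x)) (\<xi> t))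
          (at t within {0..T}) \<and>
        (\<lambda>s. \<phi> (\<eta> s)) differentiable (at t within {0..T}) \<and>
        vector_derivative (\<lambda>s. \<phi> (\<eta> s)) (at t within {0..T}) \<in> Kt \<and>
        (\<theta> has_vector_derivative
           - (pinv (gram_primal Mp B lam u (\<theta> t)) *v
              grad (\<lambda>q. E (u q)
                (\<phi> (\<eta> t) + \<gamma> *\<^sub>R vector_derivative (\<lambda>s. \<phi> (\<eta> s)) (at t within {0..T}))
                (\<psi> (\<xi> t) + \<gamma> *\<^sub>R vector_derivative (\<lambda>s. \<psi> (\<xi> s)) (at t within {0..T}))) (\<theta> t)))
          (at t within {0..T}))"

definition primal_error ::
  "('h::ab_group_add \<Rightarrow> 'v) \<Rightarrow> ('h \<Rightarrow> 'b::real_vector) \<Rightarrow> real \<Rightarrow> 'h \<Rightarrow> 'h \<Rightarrow> 'v \<times> 'b" where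
  "primal_error Mp B lam us w = (Mp (w - us), sqrt lam *\<^sub>R B (w - us))"

definition dual_pair :: "('l \<Rightarrow> 'v) \<Rightarrow> real \<Rightarrow> 'l \<Rightarrow> 'b::real_vector \<Rightarrow> 'v \<times> 'b" where
  "dual_pair Md lam p q = (Md p, sqrt lam *\<^sub>R q)"

definition primal_tangent ::
  "('h \<Rightarrow> 'v::real_inner) \<Rightarrow> ('h \<Rightarrow> 'b::real_inner) \<Rightarrow> real \<Rightarrow> (real^'p \<Rightarrow> 'h) \<Rightarrow> real^'p \<Rightarrow> ('v \<times> 'b) set" where
  "primal_tangent Mp B lam u \<theta> = span (range (\<lambda>k.
     (partial_deriv (\<lambda>\<theta>. Mp (u \<theta>)) k \<theta>, sqrt lam *\<^sub>R partial_deriv (\<lambda>\<theta>. B (u \<theta>)) k \<theta>)))"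

definition dual_tangent ::
  "('l \<Rightarrow> 'v::real_inner) \<Rightarrow> real \<Rightarrow> (real^'m \<Rightarrow> 'l) \<Rightarrow> (real^'x \<Rightarrow> 'b::real_inner) \<Rightarrow>
   real^'m \<Rightarrow> real^'x \<Rightarrow> ('v \<times> 'b) set" where
  "dual_tangent Md lam \<phi> \<psi> \<eta> \<xi> =
     span (range (\<lambda>k. partial_deriv (\<lambda>\<eta>. Md (\<phi> \<eta>)) k \<eta>)) \<times>
     span (range (\<lambda>k. sqrt lam *\<^sub>R partial_deriv \<psi> k \<xi>))"

definition relative_errors ::
  "('v::real_inner \<Rightarrow> 'v) \<Rightarrow> ('h::ab_group_add \<Rightarrow> 'v) \<Rightarrow> ('l \<Rightarrow> 'v) \<Rightarrow> ('h \<Rightarrow> 'b::real_inner) \<Rightarrow>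
   real \<Rightarrow> 'h \<Rightarrow> (real^'p \<Rightarrow> 'h) \<Rightarrow> (real^'m \<Rightarrow> 'l) \<Rightarrow> (real^'x \<Rightarrow> 'b) \<Rightarrow> real \<Rightarrow>
   (real \<Rightarrow> real^'p) \<Rightarrow> (real \<Rightarrow> real^'m) \<Rightarrow> (real \<Rightarrow> real^'x) \<Rightarrow> real \<Rightarrow> real \<Rightarrow> real \<Rightarrow> bool" where
  "relative_errors Lt Mp Md B lam us u \<phi> \<psi> T \<theta> \<eta> \<xi> \<alpha> \<beta>1 \<beta>2 \<longleftrightarrow>
     (\<forall>t\<in>{0..T}.
        let U = primal_error Mp B lam us (u (\<theta> t));
            LU = map_prod Lt id U;
            \<Phi> = dual_pair Md lam (\<phi> (\<eta> t)) (\<psi> (\<xi> t));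
            dU = primal_tangent Mp B lam u (\<theta> t);
            d\<Phi> = dual_tangent Md lam \<phi> \<psi> (\<eta> t) (\<xi> t)
        in norm (orth_proj (dU\<^sup>\<bottom>) U) \<le> \<alpha> * norm U \<and>
           norm (orth_proj (d\<Phi>\<^sup>\<bottom>) LU) \<le> \<beta>1 * norm LU \<and>
           norm (orth_proj (d\<Phi>\<^sup>\<bottom>) \<Phi>) \<le> \<beta>2 * norm \<Phi>)"

definition kappa_tilde :: "real \<Rightarrow> real \<Rightarrow> real" where
  "kappa_tilde L0 L1 = max L1 1 / min L0 1"

definition Gamma_UU :: "real \<Rightarrow> real \<Rightarrow> real \<Rightarrow> real \<Rightarrow> real \<Rightarrow> real" where
  "Gamma_UU L0 L1 \<gamma> \<alpha> \<beta>1 = \<gamma> * ((min L0 1)\<^sup>2 - (max L1 1)\<^sup>2 * (\<alpha> + \<beta>1))"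

definition Gamma_PhiPhi :: "real \<Rightarrow> real \<Rightarrow> real" where
  "Gamma_PhiPhi \<nu> \<beta>2 = \<nu> * (1 - \<beta>2)"

definition Gamma_PhiU :: "real \<Rightarrow> real \<Rightarrow> real \<Rightarrow> real \<Rightarrow> real \<Rightarrow> real \<Rightarrow> real" where
  "Gamma_PhiU L1 \<gamma> \<nu> \<alpha> \<beta>1 \<beta>2 = - max L1 1 * ((1 + \<beta>1) * \<gamma> * \<nu> + \<beta>2 + \<alpha> * \<bar>1 - \<gamma> * \<nu>\<bar>)"

definition npdg_rate :: "real \<Rightarrow> real \<Rightarrow> real \<Rightarrow> real \<Rightarrow> real \<Rightarrow> real \<Rightarrow> real \<Rightarrow> real" where
  "npdg_rate L0 L1 \<gamma> \<nu> \<alpha> \<beta>1 \<beta>2 =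
     (Gamma_UU L0 L1 \<gamma> \<alpha> \<beta>1 + Gamma_PhiPhi \<nu> \<beta>2
       - sqrt ((Gamma_UU L0 L1 \<gamma> \<alpha> \<beta>1 - Gamma_PhiPhi \<nu> \<beta>2)\<^sup>2 + (Gamma_PhiU L1 \<gamma> \<nu> \<alpha> \<beta>1 \<beta>2)\<^sup>2)) / 2"

end

theory Submission
  imports Defs
begin

text \<open>Write \<open>U = (Mp (u - us), \<surd>\<lambda> B (u - us))\<close> for the primal error, \<open>\<Phi> = (Md \<phi>, \<surd>\<lambda> \<psi>)\<close> for the
  dual variable and \<open>LL = Lt \<oplus> Id\<close>. The proof shows that the energy \<open>I = (|U|\<^sup>2 + |\<Phi>|\<^sup>2) / 2\<close> decays
  exponentially along the flow.

  Preconditioning a gradient by the pseudoinverse of a Gram matrix amounts to an orthogonal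
  projection in function space (\<open>natural_gradient_velocity\<close>). Hence the parameter flow is, in
  function space, the projected linear system \<open>\<Phi>' = \<Pi>\<^sub>\<Phi> (LL U - \<nu> \<Phi>)\<close> and
  \<open>U' = - \<Pi>\<^sub>U LL\<^sup>* (\<Phi> + \<gamma> \<Phi>')\<close> with projections onto the tangent spaces of the parametrizations
  (\<open>dual_velocity\<close>, \<open>primal_velocity\<close>). If the tangent spaces were everything, the coupling terms
  \<open>LL U \<bullet> \<Phi>\<close> would cancel in \<open>I' = U \<bullet> U' + \<Phi> \<bullet> \<Phi>'\<close>, and the extrapolation by \<open>\<gamma> \<Phi>'\<close> would add the
  damping \<open>- \<gamma> |LL U|\<^sup>2\<close> that the saddle-point structure lacks in \<open>U\<close>, at the price of a
  coupling \<open>\<gamma> \<nu> LL U \<bullet> \<Phi>\<close>, while the regularization gives \<open>- \<nu> |\<Phi>|\<^sup>2\<close>.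
  The parts of \<open>U\<close>, \<open>LL U\<close> and \<open>\<Phi>\<close> that the tangent spaces miss are controlled by \<open>\<alpha>\<close>, \<open>\<beta>1\<close> and \<open>\<beta>2\<close>. Taking them into account, \<open>I'\<close> is at most
  \<open>- (\<Gamma>\<^sub>U\<^sub>U |U|\<^sup>2 + \<Gamma>\<^sub>\<Phi>\<^sub>U |U| |\<Phi>| + \<Gamma>\<^sub>\<Phi>\<^sub>\<Phi> |\<Phi>|\<^sup>2)\<close> (\<open>dissipation_inequality\<close>).

  The rate \<open>r\<close> is the least eigenvalue of this quadratic form, which the gap condition makes
  positive (\<open>Gamma_conditions_imp_rate_pos\<close>). So \<open>I' \<le> - 2 r I\<close>, and the claim follows with the
  initial energy as \<open>C\<^sub>0\<close>.\<close>

section \<open>Natural gradients as orthogonal projections\<close>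

text \<open>The normal equations are solvable even when the \<open>e i\<close> are linearly dependent. The residual
  \<open>n = b - G G\<^sup>\<dagger> b\<close> lies in the kernel of the symmetric matrix \<open>G\<close>. For such \<open>n\<close> the
  combination \<open>\<Sum> n\<^sub>i e\<^sub>i\<close> has squared length \<open>n \<bullet> G n = 0\<close>, hence \<open>n \<bullet> b = 0\<close>; and \<open>n\<close> is also
  orthogonal to the range of \<open>G\<close>, so \<open>n \<bullet> n = 0\<close>.\<close>

lemma moore_penrose_solves_normal_equations:
  fixes e :: "'n::finite \<Rightarrow> 'a::real_inner" and w :: 'a
  defines "G \<equiv> (\<chi> i j. e i \<bullet> e j) :: real^'n^'n" and "b \<equiv> (\<chi> i. e i \<bullet> w) :: real^'n"
  shows "G *v (pinv G *v b) = b"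
proof -
  define X n where "X = pinv G" and "n = b - G *v (X *v b)"
  have mp: "G ** X ** G = G" "transpose (G ** X) = G ** X"
    using moore_penrose_pinv[of G] unfolding X_def moore_penrose_def by auto
  have G_sym: "transpose G = G"
    by (simp add: G_def transpose_def vec_eq_iff inner_commute)
  have "transpose (G ** X ** G) = G ** (G ** X)"
    using mp(2) G_sym matrix_transpose_mul[of "G ** X" G] by simp
  then have "G ** (G ** X) = G" using mp(1) G_sym by simp
  then have Gn: "G *v n = 0"
    by (simp add: n_def matrix_vector_mult_diff_distrib matrix_vector_mul_assoc matrix_mul_assoc)
  define s where "s = (\<Sum>i\<in>UNIV. n $ i *\<^sub>R e i)"
  have "s \<bullet> s = n \<bullet> (G *v n)"
    by (simp add: s_def G_def inner_sum_left inner_sum_right inner_vec_def matrix_vector_mult_def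
        sum_distrib_left sum_distrib_right mult_ac inner_commute)
  then have "s = 0" using Gn by simp
  have "n \<bullet> b = s \<bullet> w"
    by (simp add: s_def b_def inner_vec_def inner_sum_left)
  then have "n \<bullet> b = 0" using \<open>s = 0\<close> by simp
  moreover have "n \<bullet> (G *v (X *v b)) = 0"
    using Gn G_sym dot_lmul_matrix[of n G "X *v b"] by (metis inner_zero_left vector_transpose_matrix)
  ultimately have "n \<bullet> n = 0" by (simp add: n_def inner_diff_right)
  then show ?thesis by (simp add: n_def X_def)
qed

lemma mem_orthogonal_comp_span_range:
  "z \<in> (span (range e))\<^sup>\<bottom> \<longleftrightarrow> (\<forall>k. e k \<bullet> z = 0)"
proof
  assume "\<forall>k. e k \<bullet> z = 0"
  then have "orthogonal z y" if "y \<in> span (range e)" for y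
    by (intro orthogonal_to_span[OF that]) (auto simp: orthogonal_def inner_commute)
  then show "z \<in> (span (range e))\<^sup>\<bottom>"
    by (auto simp: orthogonal_comp_def orthogonal_def inner_commute)
qed (auto simp: orthogonal_comp_def orthogonal_def intro: span_base)

text \<open>Read as a statement about coefficients, the normal equations say that applying the
  pseudoinverse of the Gram matrix computes an orthogonal projection onto the span. This also
  supplies the projection onto a finite-dimensional subspace of an inner product space that may
  be infinite-dimensional.\<close>

lemma gram_pinv_projection:
  fixes e :: "'n::finite \<Rightarrow> 'a::real_inner" and w :: 'a
  defines "x \<equiv> pinv (\<chi> i j. e i \<bullet> e j) *v (\<chi> i. e i \<bullet> w)"
  shows "(\<Sum>i\<in>UNIV. x $ i *\<^sub>R e i) \<in> span (range e)"
    and "w - (\<Sum>i\<in>UNIV. x $ i *\<^sub>R e i) \<in> (span (range e))\<^sup>\<bottom>"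
proof -
  show "(\<Sum>i\<in>UNIV. x $ i *\<^sub>R e i) \<in> span (range e)"
    by (intro span_sum span_scale span_base) auto
  have "e k \<bullet> (\<Sum>i\<in>UNIV. x $ i *\<^sub>R e i) = e k \<bullet> w" for k
  proof -
    have "((\<chi> i j. e i \<bullet> e j) *v x) $ k = (\<chi> i. e i \<bullet> w) $ k"
      unfolding x_def by (rule arg_cong[OF moore_penrose_solves_normal_equations])
    then show ?thesis by (simp add: matrix_vector_mult_def inner_sum_right mult_ac)
  qed
  then show "w - (\<Sum>i\<in>UNIV. x $ i *\<^sub>R e i) \<in> (span (range e))\<^sup>\<bottom>"
    by (simp add: mem_orthogonal_comp_span_range inner_diff_right)
qed

lemma span_range_decomposition:
  fixes e :: "'n::finite \<Rightarrow> 'a::real_inner"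
  obtains p where "p \<in> span (range e)" "w - p \<in> (span (range e))\<^sup>\<bottom>"
  using gram_pinv_projection[where e = e and w = w] by blast

lemma orthogonal_comp_Times:
  "a \<in> S\<^sup>\<bottom> \<Longrightarrow> b \<in> T\<^sup>\<bottom> \<Longrightarrow> (a, b) \<in> (S \<times> T)\<^sup>\<bottom>"
  by (auto simp: orthogonal_comp_def orthogonal_def)

lemma orth_proj_orthogonal_comp:
  assumes "p \<in> V" "x - p \<in> V\<^sup>\<bottom>"
  shows "orth_proj (V\<^sup>\<bottom>) x = x - p"
  using assms orthogonal_comp_subset[of V]
  by (intro orth_proj_eq subspace_orthogonal_comp) auto

lemma projection_eqI:
  assumes "subspace V" "p \<in> V" "x - p \<in> V\<^sup>\<bottom>" "q \<in> V" "x - q \<in> V\<^sup>\<bottom>"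
  shows "p = q"
  using assms orth_proj_eq by metis

lemma linear_eq_sum_axis:
  fixes D :: "real^'n \<Rightarrow> 'a::real_vector"
  assumes "linear D"
  shows "D v = (\<Sum>i\<in>UNIV. v $ i *\<^sub>R D (axis i 1))"
proof -
  have "D v = D (\<Sum>i\<in>UNIV. v $ i *\<^sub>R axis i 1)"
    using basis_expansion[of v] by (simp add: scalar_mult_eq_scaleR)
  then show ?thesis by (simp add: linear_sum[OF assms] linear_cmul[OF assms])
qed

text \<open>The reason for preconditioning by the pseudoinverse of the Gram matrix: if the parameters \<open>x\<close>
  move along the preconditioned gradient, the represented function \<open>F \<circ> x\<close> moves along the
  orthogonal projection, onto the tangent space of the parametrization, of the function-space
  gradient \<open>w\<close>.\<close>

lemma natural_gradient_velocity:
  fixes F :: "real^'n \<Rightarrow> 'a::real_inner"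
  assumes F: "(F has_derivative D) (at (x t))"
    and x: "(x has_vector_derivative pinv (\<chi> i j. D (axis i 1) \<bullet> D (axis j 1)) *v
              (\<chi> i. D (axis i 1) \<bullet> w)) (at t within S)"
  obtains p where "p \<in> span (range (\<lambda>i. D (axis i 1)))"
    and "w - p \<in> (span (range (\<lambda>i. D (axis i 1))))\<^sup>\<bottom>"
    and "((\<lambda>s. F (x s)) has_vector_derivative p) (at t within S)"
proof -
  let ?v = "pinv (\<chi> i j. D (axis i 1) \<bullet> D (axis j 1)) *v (\<chi> i. D (axis i 1) \<bullet> w)"
  have lin: "linear D" using F by (rule has_derivative_linear)
  have "((F \<circ> x) has_derivative D \<circ> (\<lambda>h. h *\<^sub>R ?v)) (at t within S)"
    using x F unfolding has_vector_derivative_def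
    by (intro diff_chain_within) (auto intro: has_derivative_at_withinI)
  moreover have "D \<circ> (\<lambda>h. h *\<^sub>R ?v) = (\<lambda>h. h *\<^sub>R D ?v)"
    by (auto simp: linear_cmul[OF lin])
  ultimately have "((\<lambda>s. F (x s)) has_vector_derivative D ?v) (at t within S)"
    by (simp add: has_vector_derivative_def o_def)
  then show thesis
    using that gram_pinv_projection[where e = "\<lambda>i. D (axis i 1)" and w = w] linear_eq_sum_axis[OF lin, of ?v] by simp
qed

lemma grad_eq_partial_derivatives:
  fixes F :: "real^'n \<Rightarrow> real"
  assumes "(F has_derivative D) (at x)"
  shows "grad F x = (\<chi> i. D (axis i 1))"
  unfolding grad_def
proof (rule the_equality)
  let ?g = "\<chi> i. D (axis i 1)"
  have "D h = h \<bullet> ?g" for h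
    by (subst linear_eq_sum_axis[OF has_derivative_linear[OF assms], of h]) (simp add: inner_vec_def)
  then have "D = (\<lambda>h. h \<bullet> ?g)" by (rule ext)
  then show *: "GDERIV F x :> ?g" using assms unfolding gderiv_def by metis
  fix d assume "GDERIV F x :> d"
  with * have "(\<lambda>h. h \<bullet> d) = (\<lambda>h. h \<bullet> ?g)"
    unfolding gderiv_def using has_derivative_unique by metis
  then show "d = ?g" by (metis vector_eq_ldot)
qed

lemma partial_deriv_eq:
  "(F has_derivative D) (at x) \<Longrightarrow> partial_deriv F k x = D (axis k 1)"
  unfolding partial_deriv_def using frechet_derivative_at by metis

section \<open>Dissipation of the energy\<close>

lemma inner_le_mult_bounds:
  fixes x y :: "'a::real_inner"
  assumes "norm x \<le> a" "norm y \<le> b"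
  shows "\<bar>x \<bullet> y\<bar> \<le> a * b"
  using Cauchy_Schwarz_ineq2[of x y] mult_mono[OF assms] norm_ge_zero[of x] norm_ge_zero[of y] assms(1)
  by linarith

text \<open>The algebraic core. Here \<open>A\<close>, \<open>p\<close> are the projections of \<open>LU\<close>, \<open>\<Phi>\<close> onto the dual tangent
  space, \<open>R\<close>, \<open>q\<close> the parts that it misses, and \<open>LE\<close> is the image of the part of \<open>U\<close> missed by
  the primal tangent space. The left-hand side is the time derivative of half the squared norm of
  \<open>(U, \<Phi>)\<close>. The couplings \<open>\<plusminus> A \<bullet> p\<close> between the primal and the dual dynamics cancel. What is left is
  \<open>- \<gamma> A \<bullet> A - \<nu> p \<bullet> p\<close>, the extrapolation coupling \<open>\<gamma> \<nu> A \<bullet> p\<close>, and error terms.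

  The orthogonality of the missed parts matters: \<open>R \<bullet> q\<close> is of size \<open>\<beta>1 \<beta>2\<close>, while \<open>LE\<close> meets
  \<open>(1 - \<gamma> \<nu>) p + q\<close> and contributes \<open>\<alpha> \<bar>1 - \<gamma> \<nu>\<bar> + \<alpha> \<beta>2\<close>. Since \<open>\<alpha> + \<beta>1 \<le> 1\<close>, the two products
  \<open>\<beta>1 \<beta>2 + \<alpha> \<beta>2\<close> add up to at most \<open>\<beta>2\<close>.\<close>

lemma dissipation_inequality:
  fixes U E LU LE \<Phi> A R p q :: "'a::real_inner"
  assumes split: "LU = A + R" "\<Phi> = p + q"
    and orth: "A \<bullet> R = 0" "A \<bullet> q = 0" "p \<bullet> R = 0" "p \<bullet> q = 0"
    and lower: "m * norm U \<le> norm LU" and upper: "norm LU \<le> M * norm U" and "0 \<le> m"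
    and E: "norm LE \<le> M * \<alpha> * norm U"
    and R: "norm R \<le> \<beta>1 * norm LU" and q: "norm q \<le> \<beta>2 * norm \<Phi>"
    and \<alpha>: "0 \<le> \<alpha>" "\<alpha> + \<beta>1 \<le> 1" and \<beta>: "\<beta>1 \<in> {0..1}" "\<beta>2 \<in> {0..1}"
    and pos: "0 < \<gamma>" "0 < \<nu>" "0 \<le> M"
  shows "- (LU - LE) \<bullet> (\<Phi> + \<gamma> *\<^sub>R (A - \<nu> *\<^sub>R p)) + \<Phi> \<bullet> (A - \<nu> *\<^sub>R p)
    \<le> - (\<gamma> * (m\<^sup>2 - M\<^sup>2 * (\<alpha> + \<beta>1)) * (norm U)\<^sup>2
        - M * ((1 + \<beta>1) * \<gamma> * \<nu> + \<beta>2 + \<alpha> * \<bar>1 - \<gamma> * \<nu>\<bar>) * (norm U * norm \<Phi>)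
        + \<nu> * (1 - \<beta>2) * (norm \<Phi>)\<^sup>2)"
proof -
  define a b where "a = norm U" and "b = norm \<Phi>"
  have ab: "0 \<le> a" "0 \<le> b" by (auto simp: a_def b_def)
  have pyth: "(norm LU)\<^sup>2 = A \<bullet> A + (norm R)\<^sup>2" "b\<^sup>2 = p \<bullet> p + (norm q)\<^sup>2"
    using orth by (simp_all add: split b_def power2_norm_eq_inner inner_add_left inner_add_right inner_commute)
  have LU: "m * a \<le> norm LU" "norm LU \<le> M * a" using lower upper by (auto simp: a_def)
  have "norm A \<le> norm LU" "norm p \<le> b"
    using pyth ab by (auto simp: norm_eq_sqrt_inner intro!: real_le_lsqrt)
  then have nA: "norm A \<le> M * a" and np: "norm p \<le> b" using LU by auto
  have nR: "norm R \<le> \<beta>1 * (M * a)"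
    using R mult_left_mono[OF LU(2), of \<beta>1] \<beta> by auto
  have nq: "norm q \<le> \<beta>2 * b" using q by (simp add: b_def)
  have nE: "norm LE \<le> M * \<alpha> * a" using E by (simp add: a_def)
  have expand: "- (LU - LE) \<bullet> (\<Phi> + \<gamma> *\<^sub>R (A - \<nu> *\<^sub>R p)) + \<Phi> \<bullet> (A - \<nu> *\<^sub>R p)
    = - \<gamma> * (A \<bullet> A) - R \<bullet> q + \<gamma> * \<nu> * (A \<bullet> p) - \<nu> * (p \<bullet> p)
      + LE \<bullet> (((1 - \<gamma> * \<nu>) *\<^sub>R \<Phi> + (\<gamma> * \<nu>) *\<^sub>R q)) + \<gamma> * (LE \<bullet> A)"
    using orth by (simp add: split inner_simps inner_commute algebra_simps)
  have AA: "(m\<^sup>2 - M\<^sup>2 * \<beta>1) * a\<^sup>2 \<le> A \<bullet> A"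
  proof -
    have "(norm R)\<^sup>2 \<le> (\<beta>1 * (M * a))\<^sup>2" using nR by (intro power_mono) auto
    also have "\<dots> = (\<beta>1 * \<beta>1) * (M\<^sup>2 * a\<^sup>2)" by (simp add: power2_eq_square algebra_simps)
    also have "\<dots> \<le> \<beta>1 * (M\<^sup>2 * a\<^sup>2)"
      using \<beta> mult_right_mono[of "\<beta>1*\<beta>1" \<beta>1 "M\<^sup>2 * a\<^sup>2"] mult_left_le[of \<beta>1 \<beta>1] by simp
    finally have 1: "(norm R)\<^sup>2 \<le> \<beta>1 * (M\<^sup>2 * a\<^sup>2)" .
    have "(m * a)\<^sup>2 \<le> (norm LU)\<^sup>2" using LU \<open>0 \<le> m\<close> ab by (intro power_mono) auto
    then show ?thesis using 1 pyth by (simp add: power_mult_distrib algebra_simps)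
  qed
  have pp: "(1 - \<beta>2) * b\<^sup>2 \<le> p \<bullet> p"
  proof -
    have "(norm q)\<^sup>2 \<le> (\<beta>2 * b)\<^sup>2" using nq by (intro power_mono) auto
    also have "\<dots> = (\<beta>2 * \<beta>2) * b\<^sup>2" by (simp add: power2_eq_square algebra_simps)
    also have "\<dots> \<le> \<beta>2 * b\<^sup>2" using \<beta> by (intro mult_right_mono) (auto simp: mult_left_le)
    finally show ?thesis using pyth by (simp add: algebra_simps)
  qed
  have Rq: "- (R \<bullet> q) \<le> \<beta>1 * \<beta>2 * (M * (a * b))"
    using inner_le_mult_bounds[OF nR nq] by (simp add: mult_ac abs_le_iff)
  have Ap: "A \<bullet> p \<le> M * (a * b)"
    using inner_le_mult_bounds[OF nA np] by (simp add: mult_ac abs_le_iff)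
  have EA: "LE \<bullet> A \<le> M\<^sup>2 * \<alpha> * a\<^sup>2"
    using inner_le_mult_bounds[OF nE nA] by (simp add: mult_ac abs_le_iff power2_eq_square)
  have "norm ((1 - \<gamma> * \<nu>) *\<^sub>R \<Phi> + (\<gamma> * \<nu>) *\<^sub>R q) \<le> \<bar>1 - \<gamma> * \<nu>\<bar> * b + \<beta>2 * b"
  proof -
    \<comment> \<open>estimating \<open>\<Phi>\<close> and \<open>q\<close> separately would leave \<open>\<gamma> \<nu> \<beta>2\<close> instead of \<open>\<beta>2\<close>\<close>
    have "(1 - \<gamma> * \<nu>) *\<^sub>R \<Phi> + (\<gamma> * \<nu>) *\<^sub>R q = (1 - \<gamma> * \<nu>) *\<^sub>R p + q"
      by (simp add: split algebra_simps)
    moreover have "norm ((1 - \<gamma> * \<nu>) *\<^sub>R p) \<le> \<bar>1 - \<gamma> * \<nu>\<bar> * b"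
      using np by (simp add: mult_left_mono)
    ultimately show ?thesis using nq norm_triangle_le by (metis add_mono)
  qed
  from inner_le_mult_bounds[OF nE this]
  have E\<Phi>: "LE \<bullet> ((1 - \<gamma> * \<nu>) *\<^sub>R \<Phi> + (\<gamma> * \<nu>) *\<^sub>R q) \<le> \<alpha> * (\<bar>1 - \<gamma> * \<nu>\<bar> + \<beta>2) * (M * (a * b))"
    by (simp add: algebra_simps abs_le_iff)
  have "(\<alpha> + \<beta>1) * \<beta>2 \<le> 1 * \<beta>2" using \<alpha> \<beta> by (intro mult_right_mono) auto
  moreover have "0 \<le> \<beta>1 * (\<gamma> * \<nu>)" using \<beta> pos by simp
  ultimately have "\<beta>1 * \<beta>2 + \<gamma> * \<nu> + \<alpha> * (\<bar>1 - \<gamma> * \<nu>\<bar> + \<beta>2)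
      \<le> (1 + \<beta>1) * \<gamma> * \<nu> + \<beta>2 + \<alpha> * \<bar>1 - \<gamma> * \<nu>\<bar>" by (simp add: algebra_simps)
  from mult_right_mono[OF this, of "M * (a * b)"]
  have cross: "\<beta>1 * \<beta>2 * (M * (a * b)) + \<gamma> * \<nu> * (M * (a * b)) + \<alpha> * (\<bar>1 - \<gamma> * \<nu>\<bar> + \<beta>2) * (M * (a * b))
      \<le> M * ((1 + \<beta>1) * \<gamma> * \<nu> + \<beta>2 + \<alpha> * \<bar>1 - \<gamma> * \<nu>\<bar>) * (a * b)"
    using pos ab by (simp add: algebra_simps)
  have "\<gamma> * ((m\<^sup>2 - M\<^sup>2 * \<beta>1) * a\<^sup>2) \<le> \<gamma> * (A \<bullet> A)" "\<nu> * ((1 - \<beta>2) * b\<^sup>2) \<le> \<nu> * (p \<bullet> p)"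
    "\<gamma> * \<nu> * (A \<bullet> p) \<le> \<gamma> * \<nu> * (M * (a * b))" "\<gamma> * (LE \<bullet> A) \<le> \<gamma> * (M\<^sup>2 * \<alpha> * a\<^sup>2)"
    using AA pp Ap EA pos by (auto intro: mult_left_mono)
  then show ?thesis
    unfolding expand a_def[symmetric] b_def[symmetric]
    using Rq E\<Phi> cross by (simp add: algebra_simps)
qed

text \<open>The factor on the left is the smaller eigenvalue of the symmetric matrix with rows
  \<open>(a, c/2)\<close> and \<open>(c/2, b)\<close>. The bound is Cauchy--Schwarz for \<open>(a - b, c)\<close> and
  \<open>(x\<^sup>2 - y\<^sup>2, 2xy)\<close>, the latter of length \<open>x\<^sup>2 + y\<^sup>2\<close>.\<close>

lemma quadratic_form_ge_least_eigenvalue: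
  fixes a b c x y :: real
  shows "(a + b - sqrt ((a - b)\<^sup>2 + c\<^sup>2)) / 2 * (x\<^sup>2 + y\<^sup>2) \<le> a * x\<^sup>2 + c * (x * y) + b * y\<^sup>2"
proof -
  have "\<bar>(a - b, c) \<bullet> (x\<^sup>2 - y\<^sup>2, 2 * x * y)\<bar> \<le> norm (a - b, c) * norm (x\<^sup>2 - y\<^sup>2, 2 * x * y)"
    by (rule Cauchy_Schwarz_ineq2)
  moreover have "(x\<^sup>2 - y\<^sup>2)\<^sup>2 + (2 * x * y)\<^sup>2 = (x\<^sup>2 + y\<^sup>2)\<^sup>2"
    by (simp add: power2_eq_square algebra_simps)
  then have "norm (x\<^sup>2 - y\<^sup>2, 2 * x * y) = x\<^sup>2 + y\<^sup>2"
    by (simp add: norm_Pair)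
  ultimately have "- (sqrt ((a - b)\<^sup>2 + c\<^sup>2) * (x\<^sup>2 + y\<^sup>2)) \<le> (a - b) * (x\<^sup>2 - y\<^sup>2) + c * (2 * x * y)"
    by (simp add: norm_Pair abs_le_iff)
  then show ?thesis by (simp add: field_simps)
qed

lemma gronwall_exponential_decay:
  fixes I :: "real \<Rightarrow> real"
  assumes der: "\<And>s. s \<in> {0..T} \<Longrightarrow> (I has_real_derivative d s) (at s within {0..T})"
    and le: "\<And>s. s \<in> {0..T} \<Longrightarrow> d s \<le> - r * I s"
    and t: "t \<in> {0..T}"
  shows "I t \<le> exp (- r * t) * I 0"
proof -
  let ?J = "\<lambda>s. exp (r * s) * I s"
  have J: "(?J has_real_derivative exp (r * s) * (r * I s + d s)) (at s within {0..T})"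
    if "s \<in> {0..T}" for s
    by (rule derivative_eq_intros der[OF that] refl)+ (simp add: algebra_simps)
  have "?J t \<le> ?J 0"
  proof (rule DERIV_nonpos_imp_decreasing_open[of 0 t ?J])
    fix s assume s: "0 < s" "s < t"
    then have "s \<in> {0..T}" "at s within {0..T} = at s"
      using t by (auto intro: at_within_Icc_at)
    then show "\<exists>y. (?J has_real_derivative y) (at s) \<and> y \<le> 0"
      using J[of s] le[of s] by (intro exI[of _ "exp (r * s) * (r * I s + d s)"])
        (auto simp: mult_le_0_iff)
  next
    have "continuous_on {0..T} ?J" using J by (rule DERIV_continuous_on)
    then show "continuous_on {0..t} ?J" using t by (auto elim: continuous_on_subset)
  qed (use t in auto)
  then have "exp (- r * t) * (exp (r * t) * I t) \<le> exp (- r * t) * I 0"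
    by (intro mult_left_mono) auto
  then show ?thesis by (simp add: mult.assoc[symmetric] exp_add[symmetric])
qed

section \<open>The flow as a pair of projected linear dynamics\<close>

lemma linear_op_on_diff:
  assumes "linear_op_on S T A" "subspace S" "x \<in> S" "y \<in> S"
  shows "A (x - y) = A x - A y"
proof -
  have "A (x + (-1) *\<^sub>R y) = A x + A ((-1) *\<^sub>R y)" "A ((-1) *\<^sub>R y) = (-1) *\<^sub>R A y"
    using assms subspace_scale[of S y "-1"] unfolding linear_op_on_def by blast+
  then show ?thesis by simp
qed

text \<open>A chain rule for an operator that is linear and bounded only on a subspace \<open>S\<close>: both the
  increments of \<open>F\<close> and the values of its derivative stay in \<open>S\<close>, so the remainder does too and
  the bound applies to it.\<close>

lemma has_derivative_bounded_op_on:
  fixes F :: "real^'n \<Rightarrow> 'a::real_normed_vector" and A :: "'a \<Rightarrow> 'b::real_normed_vector"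
  assumes F: "(F has_derivative D) (at x)" and A: "linear_op_on S T A" and S: "subspace S"
    and FS: "\<And>y. F y \<in> S" and DS: "\<And>k. D (axis k 1) \<in> S"
    and c: "0 < c" "\<And>v. v \<in> S \<Longrightarrow> norm (A v) \<le> c * norm v"
  shows "((\<lambda>y. A (F y)) has_derivative (\<lambda>h. A (D h))) (at x)"
  unfolding has_derivative_at_alt
proof (intro conjI allI impI)
  have linD: "linear D" using F by (rule has_derivative_linear)
  have D: "D h \<in> S" for h
    by (subst linear_eq_sum_axis[OF linD]) (intro subspace_sum subspace_scale S DS)
  have "linear (\<lambda>h. A (D h))"
    using A D by (intro linearI) (auto simp: linear_op_on_def linear_add[OF linD] linear_cmul[OF linD])
  then show "bounded_linear (\<lambda>h. A (D h))" by (simp add: linear_conv_bounded_linear)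
  fix e :: real assume "0 < e"
  then have "0 < e / c" using c by simp
  then obtain d where d: "0 < d"
    "\<And>y. norm (y - x) < d \<Longrightarrow> norm (F y - F x - D (y - x)) \<le> e / c * norm (y - x)"
    using F unfolding has_derivative_at_alt by blast
  have "norm (A (F y) - A (F x) - A (D (y - x))) \<le> e * norm (y - x)" if "norm (y - x) < d" for y
  proof -
    have "A (F y) - A (F x) - A (D (y - x)) = A (F y - F x - D (y - x))"
      using FS D S by (simp add: linear_op_on_diff[OF A S] subspace_diff)
    also have "norm \<dots> \<le> c * norm (F y - F x - D (y - x))"
      using FS D S by (intro c) (auto intro: subspace_diff)
    also have "\<dots> \<le> c * (e / c * norm (y - x))" using d(2)[OF that] c by (intro mult_left_mono) auto
    finally show ?thesis using c by simp
  qed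
  then show "\<exists>d>0. \<forall>y. norm (y - x) < d \<longrightarrow> norm (A (F y) - A (F x) - A (D (y - x))) \<le> e * norm (y - x)"
    using d(1) by blast
qed

lemma partial_deriv_add_const:
  assumes "F differentiable (at x)" "\<And>y. F' y = F y + c"
  shows "partial_deriv F' k x = partial_deriv F k x"
proof -
  obtain D where D: "(F has_derivative D) (at x)" using assms(1) by (auto simp: differentiable_def)
  have "F' = (\<lambda>y. F y + c)" using assms(2) by auto
  with D have "(F' has_derivative D) (at x)" by (auto intro!: derivative_eq_intros)
  then show ?thesis using D by (simp add: partial_deriv_eq)
qed

text \<open>The part of the setting that drives the decay estimate. The data of the equation are
  expressed through the solution \<open>us\<close>, as \<open>f = Mds (Lt (Mp us))\<close> and \<open>g = B us\<close>.\<close>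

locale npdg_problem =
  fixes Ktest :: "'l::real_inner set" and Ht Kt Kttest :: "'v::real_inner set"
    and B :: "'h::real_vector \<Rightarrow> 'b::real_inner" and Mp :: "'h \<Rightarrow> 'v"
    and Lt Lt_adj :: "'v \<Rightarrow> 'v" and Mds :: "'v \<Rightarrow> 'l" and Md :: "'l \<Rightarrow> 'v"
    and us :: 'h and L0 L1 \<gamma> \<nu> lam :: real
    and \<Theta> :: "(real^'p) set" and Hp :: "(real^'m) set" and \<Xi> :: "(real^'x) set"
    and u :: "real^'p \<Rightarrow> 'h" and \<phi> :: "real^'m \<Rightarrow> 'l" and \<psi> :: "real^'x \<Rightarrow> 'b"
  assumes Ht: "subspace Ht" and Kttest: "subspace Kttest" and Ktest: "subspace Ktest"
    and B_linear: "linear_op_on UNIV UNIV B" and Mp_linear: "linear_op_on UNIV Ht Mp"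
    and Lt_linear: "linear_op_on Ht Kt Lt" and Md_linear: "linear_op_on Ktest Kttest Md"
    and Mds_adjoint: "\<And>w p. w \<in> Kt \<Longrightarrow> p \<in> Ktest \<Longrightarrow> Mds w \<bullet> p = w \<bullet> Md p"
    and L0_pos: "0 < L0" and L0_le_L1: "L0 \<le> L1"
    and Lt_lower: "\<And>w. w \<in> Ht \<Longrightarrow> L0 * norm w \<le> norm (Lt w)"
    and Lt_upper: "\<And>w. w \<in> Ht \<Longrightarrow> norm (Lt w) \<le> L1 * norm w"
    and Lt_adjoint: "\<And>v w. v \<in> Ht \<Longrightarrow> w \<in> Kttest \<Longrightarrow> Lt v \<bullet> w = v \<bullet> Lt_adj w"
    and open_Hp: "open Hp"
    and \<phi>_Ktest: "\<And>\<eta>. \<eta> \<in> Hp \<Longrightarrow> \<phi> \<eta> \<in> Ktest"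
    and Mp_diff: "\<And>\<theta>. \<theta> \<in> \<Theta> \<Longrightarrow> (\<lambda>\<theta>. Mp (u \<theta> - us)) differentiable (at \<theta>)"
    and Mp_partial: "\<And>\<theta> k. \<theta> \<in> \<Theta> \<Longrightarrow> partial_deriv (\<lambda>\<theta>. Mp (u \<theta> - us)) k \<theta> \<in> Ht"
    and B_diff: "\<And>\<theta>. \<theta> \<in> \<Theta> \<Longrightarrow> (\<lambda>\<theta>. B (u \<theta> - us)) differentiable (at \<theta>)"
    and Md_diff: "\<And>\<eta>. \<eta> \<in> Hp \<Longrightarrow> (\<lambda>\<eta>. Md (\<phi> \<eta>)) differentiable (at \<eta>)"
    and Md_partial: "\<And>\<eta> k. \<eta> \<in> Hp \<Longrightarrow> partial_deriv (\<lambda>\<eta>. Md (\<phi> \<eta>)) k \<eta> \<in> Kttest"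
    and \<psi>_diff: "\<And>\<xi>. \<xi> \<in> \<Xi> \<Longrightarrow> \<psi> differentiable (at \<xi>)"
    and \<gamma>_pos: "0 < \<gamma>" and \<nu>_pos: "0 < \<nu>" and lam_pos: "0 < lam"
begin

abbreviation E :: "'h \<Rightarrow> 'l \<Rightarrow> 'b \<Rightarrow> real" where
  "E \<equiv> npdg_functional Lt Mp Md B (Mds (Lt (Mp us))) (B us) \<nu> lam"

text \<open>The factor \<open>sqrt lam\<close> in the boundary components of \<open>U\<close> and \<open>\<Phi>\<close> turns the weighted inner
  products of the functional and of the Gram matrices into the plain one of the product space.
  \<open>LL\<close> is \<open>Lt \<oplus> Id\<close>.\<close>

abbreviation U :: "real^'p \<Rightarrow> 'v \<times> 'b" where
  "U q \<equiv> primal_error Mp B lam us (u q)"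

abbreviation \<Phi> :: "real^'m \<Rightarrow> real^'x \<Rightarrow> 'v \<times> 'b" where
  "\<Phi> e x \<equiv> dual_pair Md lam (\<phi> e) (\<psi> x)"

abbreviation LL :: "'v \<times> 'b \<Rightarrow> 'v \<times> 'b" where
  "LL \<equiv> map_prod Lt id"

abbreviation flow where
  "flow T \<theta> \<eta> \<xi> \<equiv> npdg_flow E Mp Md B Ktest \<gamma> lam \<Theta> Hp \<Xi> u \<phi> \<psi> T \<theta> \<eta> \<xi>"

lemma sqrt_lam: "sqrt lam * sqrt lam = lam" "sqrt lam > 0" "sqrt lam * (sqrt lam * c) = lam * c"
  using lam_pos by (simp_all add: mult.assoc[symmetric])

lemma Mp_diff_us: "Mp (w - us) = Mp w - Mp us" and B_diff_us: "B (w - us) = B w - B us"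
  using linear_op_on_diff[OF Mp_linear subspace_UNIV] linear_op_on_diff[OF B_linear subspace_UNIV]
  by auto

lemma Mp_in_Ht: "Mp w \<in> Ht"
  using Mp_linear by (auto simp: linear_op_on_def)

lemma Lt_in_Kt: "v \<in> Ht \<Longrightarrow> Lt v \<in> Kt"
  using Lt_linear by (auto simp: linear_op_on_def)

text \<open>Because \<open>us\<close> solves the equation and \<open>Md\<close> is adjoint to \<open>Mds\<close>, the source term can be moved
  into the bilinear part. The functional then depends on \<open>w\<close> only through the error \<open>w - us\<close>, and
  on \<open>p\<close> only through \<open>Md p\<close>, which is what is assumed to be differentiable.\<close>

lemma functional_centered_at_solution:
  assumes "p \<in> Ktest"
  shows "E w p q = Lt (Mp (w - us)) \<bullet> Md p + lam * (B (w - us) \<bullet> q)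
    - \<nu> / 2 * (Md p \<bullet> Md p + lam * (q \<bullet> q))"
proof -
  have "Mds (Lt (Mp us)) \<bullet> p = Lt (Mp us) \<bullet> Md p"
    using assms by (intro Mds_adjoint Lt_in_Kt Mp_in_Ht)
  moreover have "Lt (Mp (w - us)) = Lt (Mp w) - Lt (Mp us)"
    unfolding Mp_diff_us by (intro linear_op_on_diff[OF Lt_linear Ht] Mp_in_Ht)
  ultimately show ?thesis
    by (simp add: npdg_functional_def B_diff_us inner_diff_left power2_norm_eq_inner)
qed

lemma grad_dual:
  assumes "e \<in> Hp"
  shows "grad (\<lambda>e. E w (\<phi> e) q) e =
    (\<chi> i. partial_deriv (\<lambda>e. Md (\<phi> e)) i e \<bullet> (Lt (Mp (w - us)) - \<nu> *\<^sub>R Md (\<phi> e)))"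
proof -
  obtain D where D: "((\<lambda>e. Md (\<phi> e)) has_derivative D) (at e)"
    using Md_diff[OF assms] by (auto simp: differentiable_def)
  have "((\<lambda>e. Lt (Mp (w - us)) \<bullet> Md (\<phi> e) + lam * (B (w - us) \<bullet> q)
      - \<nu> / 2 * (Md (\<phi> e) \<bullet> Md (\<phi> e) + lam * (q \<bullet> q)))
      has_derivative (\<lambda>h. D h \<bullet> (Lt (Mp (w - us)) - \<nu> *\<^sub>R Md (\<phi> e)))) (at e)"
    by (auto intro!: derivative_eq_intros D simp: inner_diff_right inner_commute algebra_simps)
  then have "((\<lambda>e. E w (\<phi> e) q) has_derivative
      (\<lambda>h. D h \<bullet> (Lt (Mp (w - us)) - \<nu> *\<^sub>R Md (\<phi> e)))) (at e)"
    by (rule has_derivative_transform_within_open[OF _ open_Hp assms])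
      (simp add: functional_centered_at_solution \<phi>_Ktest)
  then show ?thesis by (simp add: grad_eq_partial_derivatives partial_deriv_eq[OF D])
qed

lemma grad_boundary:
  assumes "x \<in> \<Xi>" "p \<in> Ktest"
  shows "grad (\<lambda>x. E w p (\<psi> x)) x =
    (\<chi> i. (sqrt lam *\<^sub>R partial_deriv \<psi> i x) \<bullet> (sqrt lam *\<^sub>R (B (w - us) - \<nu> *\<^sub>R \<psi> x)))"
proof -
  obtain D where D: "(\<psi> has_derivative D) (at x)"
    using \<psi>_diff[OF assms(1)] by (auto simp: differentiable_def)
  have "((\<lambda>x. E w p (\<psi> x)) has_derivative (\<lambda>h. lam * (D h \<bullet> (B (w - us) - \<nu> *\<^sub>R \<psi> x)))) (at x)"
    unfolding functional_centered_at_solution[OF assms(2)]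
    by (auto intro!: derivative_eq_intros D simp: inner_diff_right inner_commute algebra_simps)
  then show ?thesis
    by (simp add: grad_eq_partial_derivatives partial_deriv_eq[OF D] sqrt_lam)
qed

lemma grad_primal:
  assumes "q \<in> \<Theta>" "p \<in> Ktest"
  shows "grad (\<lambda>q. E (u q) p s) q =
    (\<chi> k. Lt (partial_deriv (\<lambda>q. Mp (u q - us)) k q) \<bullet> Md p
        + lam * (partial_deriv (\<lambda>q. B (u q - us)) k q \<bullet> s))"
proof -
  obtain D where D: "((\<lambda>q. Mp (u q - us)) has_derivative D) (at q)"
    using Mp_diff[OF assms(1)] by (auto simp: differentiable_def)
  obtain D' where D': "((\<lambda>q. B (u q - us)) has_derivative D') (at q)"
    using B_diff[OF assms(1)] by (auto simp: differentiable_def)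
  have "((\<lambda>q. Lt (Mp (u q - us))) has_derivative (\<lambda>h. Lt (D h))) (at q)"
    using Mp_partial[OF assms(1)] L0_pos L0_le_L1
    by (intro has_derivative_bounded_op_on[OF D Lt_linear Ht _ _ _ Lt_upper] Mp_in_Ht)
      (auto simp: partial_deriv_eq[OF D])
  then have "((\<lambda>q. E (u q) p s) has_derivative (\<lambda>h. Lt (D h) \<bullet> Md p + lam * (D' h \<bullet> s))) (at q)"
    unfolding functional_centered_at_solution[OF assms(2)]
    by (auto intro!: derivative_eq_intros D')
  then show ?thesis
    by (simp add: grad_eq_partial_derivatives partial_deriv_eq[OF D] partial_deriv_eq[OF D'])
qed

text \<open>The flow uses \<open>Md\<close> applied to the velocity of \<open>\<phi>\<close>, whereas the energy needs the velocity of
  \<open>Md \<circ> \<phi>\<close>. As \<open>Md\<close> may be unbounded, these need not agree as vectors; but they agree when tested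
  against \<open>Kt\<close>, because \<open>w \<bullet> Md p = Mds w \<bullet> p\<close> is continuous in \<open>p\<close>.
  The range of \<open>Lt\<close> lies in \<open>Kt\<close>, so this is enough.\<close>

lemma Md_commutes_weakly_with_time_derivative:
  assumes t: "0 < T" "t \<in> {0..T}" and P: "\<And>s. s \<in> {0..T} \<Longrightarrow> P s \<in> Ktest"
    and d: "(P has_vector_derivative d) (at t within {0..T})" "d \<in> Ktest"
    and d': "((\<lambda>s. Md (P s)) has_vector_derivative d') (at t within {0..T})"
    and w: "w \<in> Kt"
  shows "w \<bullet> Md d = w \<bullet> d'"
proof -
  have "((\<lambda>s. Mds w \<bullet> P s) has_vector_derivative Mds w \<bullet> d) (at t within {0..T})"
    by (rule bounded_linear.has_vector_derivative[OF bounded_linear_inner_right d(1)])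
  then have "((\<lambda>s. w \<bullet> Md (P s)) has_vector_derivative Mds w \<bullet> d) (at t within {0..T})"
    by (rule has_vector_derivative_transform[OF t(2), rotated]) (simp add: Mds_adjoint w P)
  moreover have "((\<lambda>s. w \<bullet> Md (P s)) has_vector_derivative w \<bullet> d') (at t within {0..T})"
    by (rule bounded_linear.has_vector_derivative[OF bounded_linear_inner_right d'])
  ultimately have "Mds w \<bullet> d = w \<bullet> d'"
    using t vector_derivative_unique_within_closed_interval[of 0 T t] by simp
  then show ?thesis using Mds_adjoint[OF w d(2)] by simp
qed

lemma flowD:
  assumes "flow T \<theta> \<eta> \<xi>" "t \<in> {0..T}"
  shows "\<theta> t \<in> \<Theta>" "\<eta> t \<in> Hp" "\<xi> t \<in> \<Xi>"
    and "(\<eta> has_vector_derivative pinv (gram_dual Md \<phi> (\<eta> t)) *v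
          grad (\<lambda>e. E (u (\<theta> t)) (\<phi> e) (\<psi> (\<xi> t))) (\<eta> t)) (at t within {0..T})"
    and "(\<xi> has_vector_derivative pinv (gram_bdd lam \<psi> (\<xi> t)) *v
          grad (\<lambda>x. E (u (\<theta> t)) (\<phi> (\<eta> t)) (\<psi> x)) (\<xi> t)) (at t within {0..T})"
    and "(\<lambda>s. \<phi> (\<eta> s)) differentiable (at t within {0..T})"
    and "vector_derivative (\<lambda>s. \<phi> (\<eta> s)) (at t within {0..T}) \<in> Ktest"
    and "(\<theta> has_vector_derivative - (pinv (gram_primal Mp B lam u (\<theta> t)) *v
          grad (\<lambda>q. E (u q)
            (\<phi> (\<eta> t) + \<gamma> *\<^sub>R vector_derivative (\<lambda>s. \<phi> (\<eta> s)) (at t within {0..T}))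
            (\<psi> (\<xi> t) + \<gamma> *\<^sub>R vector_derivative (\<lambda>s. \<psi> (\<xi> s)) (at t within {0..T}))) (\<theta> t)))
          (at t within {0..T})"
  using assms unfolding npdg_flow_def by blast+

text \<open>In function space the dual parameters perform projected gradient ascent: the velocity of \<open>\<Phi>\<close>
  is the projection of \<open>LL U - \<nu> \<Phi>\<close> onto the dual tangent space. The two components of the
  velocity are kept separate, since the primal equation refers to them separately.\<close>

lemma dual_velocity:
  assumes flow: "flow T \<theta> \<eta> \<xi>" and t: "t \<in> {0..T}"
  obtains Q1 Q2 where
    "Q1 \<in> span (range (\<lambda>k. partial_deriv (\<lambda>\<eta>. Md (\<phi> \<eta>)) k (\<eta> t)))"
    "((\<lambda>s. Md (\<phi> (\<eta> s))) has_vector_derivative Q1) (at t within {0..T})"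
    "((\<lambda>s. sqrt lam *\<^sub>R \<psi> (\<xi> s)) has_vector_derivative Q2) (at t within {0..T})"
    "(Q1, Q2) \<in> dual_tangent Md lam \<phi> \<psi> (\<eta> t) (\<xi> t)"
    "LL (U (\<theta> t)) - \<nu> *\<^sub>R \<Phi> (\<eta> t) (\<xi> t) - (Q1, Q2) \<in> (dual_tangent Md lam \<phi> \<psi> (\<eta> t) (\<xi> t))\<^sup>\<bottom>"
proof -
  have in_dom: "\<eta> t \<in> Hp" "\<xi> t \<in> \<Xi>" using flowD(2,3)[OF flow t] by auto
  obtain D where D: "((\<lambda>e. Md (\<phi> e)) has_derivative D) (at (\<eta> t))"
    using Md_diff[OF in_dom(1)] by (auto simp: differentiable_def)
  obtain D' where D': "(\<psi> has_derivative D') (at (\<xi> t))"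
    using \<psi>_diff[OF in_dom(2)] by (auto simp: differentiable_def)
  have sD': "((\<lambda>x. sqrt lam *\<^sub>R \<psi> x) has_derivative (\<lambda>h. sqrt lam *\<^sub>R D' h)) (at (\<xi> t))"
    by (auto intro!: derivative_eq_intros D')
  let ?w1 = "Lt (Mp (u (\<theta> t) - us)) - \<nu> *\<^sub>R Md (\<phi> (\<eta> t))"
  let ?w2 = "sqrt lam *\<^sub>R (B (u (\<theta> t) - us) - \<nu> *\<^sub>R \<psi> (\<xi> t))"
  have "(\<eta> has_vector_derivative pinv (\<chi> i j. D (axis i 1) \<bullet> D (axis j 1)) *v
      (\<chi> i. D (axis i 1) \<bullet> ?w1)) (at t within {0..T})"
    using flowD(4)[OF flow t]
    unfolding grad_dual[OF in_dom(1)] gram_dual_def partial_deriv_eq[OF D] .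
  then obtain Q1 where Q1: "Q1 \<in> span (range (\<lambda>i. D (axis i 1)))"
    "?w1 - Q1 \<in> (span (range (\<lambda>i. D (axis i 1))))\<^sup>\<bottom>"
    "((\<lambda>s. Md (\<phi> (\<eta> s))) has_vector_derivative Q1) (at t within {0..T})"
    by (rule natural_gradient_velocity[where x = \<eta>, OF D])
  have gram: "gram_bdd lam \<psi> (\<xi> t) =
      (\<chi> i j. (sqrt lam *\<^sub>R D' (axis i 1)) \<bullet> (sqrt lam *\<^sub>R D' (axis j 1)))"
    by (simp add: gram_bdd_def partial_deriv_eq[OF D'] sqrt_lam)
  have "(\<xi> has_vector_derivative pinv (\<chi> i j. (sqrt lam *\<^sub>R D' (axis i 1)) \<bullet> (sqrt lam *\<^sub>R D' (axis j 1))) *v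
      (\<chi> i. (sqrt lam *\<^sub>R D' (axis i 1)) \<bullet> ?w2)) (at t within {0..T})"
    using flowD(5)[OF flow t]
    unfolding gram grad_boundary[OF in_dom(2) \<phi>_Ktest[OF in_dom(1)]] partial_deriv_eq[OF D'] .
  then obtain Q2 where Q2: "Q2 \<in> span (range (\<lambda>i. sqrt lam *\<^sub>R D' (axis i 1)))"
    "?w2 - Q2 \<in> (span (range (\<lambda>i. sqrt lam *\<^sub>R D' (axis i 1))))\<^sup>\<bottom>"
    "((\<lambda>s. sqrt lam *\<^sub>R \<psi> (\<xi> s)) has_vector_derivative Q2) (at t within {0..T})"
    by (rule natural_gradient_velocity[where x = \<xi>, OF sD'])
  have tangent: "dual_tangent Md lam \<phi> \<psi> (\<eta> t) (\<xi> t) =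
      span (range (\<lambda>i. D (axis i 1))) \<times> span (range (\<lambda>i. sqrt lam *\<^sub>R D' (axis i 1)))"
    by (simp add: dual_tangent_def partial_deriv_eq[OF D] partial_deriv_eq[OF D'])
  have "LL (U (\<theta> t)) - \<nu> *\<^sub>R \<Phi> (\<eta> t) (\<xi> t) - (Q1, Q2) = (?w1 - Q1, ?w2 - Q2)"
    by (simp add: primal_error_def dual_pair_def algebra_simps)
  then have "LL (U (\<theta> t)) - \<nu> *\<^sub>R \<Phi> (\<eta> t) (\<xi> t) - (Q1, Q2)
      \<in> (dual_tangent Md lam \<phi> \<psi> (\<eta> t) (\<xi> t))\<^sup>\<bottom>"
    using Q1 Q2 by (simp add: tangent orthogonal_comp_Times)
  then show thesis
    using Q1 Q2 by (intro that[of Q1 Q2]) (simp_all add: tangent partial_deriv_eq[OF D])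
qed

lemma fst_primal_tangent_in_Ht:
  assumes "q \<in> \<Theta>" "V \<in> primal_tangent Mp B lam u q"
  shows "fst V \<in> Ht"
proof -
  have "partial_deriv (\<lambda>\<theta>. Mp (u \<theta>)) k q = partial_deriv (\<lambda>\<theta>. Mp (u \<theta> - us)) k q" for k
    by (rule partial_deriv_add_const[OF Mp_diff[OF assms(1)], of _ "Mp us"]) (simp add: Mp_diff_us)
  then have "primal_tangent Mp B lam u q \<subseteq> Ht \<times> UNIV"
    unfolding primal_tangent_def using Mp_partial[OF assms(1)] Ht
    by (intro span_minimal) (auto intro: subspace_Times)
  then show ?thesis using assms(2) by auto
qed

text \<open>The primal velocity is the projection, onto the primal tangent space, of minus the adjoint of
  \<open>LL\<close> applied to the extrapolated dual variable \<open>\<Phi> + \<gamma> \<Phi>'\<close>. It is enough to know it tested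
  against tangent vectors \<open>V\<close>, and there the adjoint can be moved back to \<open>LL V\<close>.\<close>

lemma primal_velocity:
  assumes flow: "flow T \<theta> \<eta> \<xi>" and t: "0 < T" "t \<in> {0..T}"
    and Q1: "Q1 \<in> span (range (\<lambda>k. partial_deriv (\<lambda>\<eta>. Md (\<phi> \<eta>)) k (\<eta> t)))"
      "((\<lambda>s. Md (\<phi> (\<eta> s))) has_vector_derivative Q1) (at t within {0..T})"
    and Q2: "((\<lambda>s. sqrt lam *\<^sub>R \<psi> (\<xi> s)) has_vector_derivative Q2) (at t within {0..T})"
  obtains P where "P \<in> primal_tangent Mp B lam u (\<theta> t)"
    "((\<lambda>s. U (\<theta> s)) has_vector_derivative P) (at t within {0..T})"
    "\<And>V. V \<in> primal_tangent Mp B lam u (\<theta> t) \<Longrightarrow>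
      V \<bullet> P = - (LL V \<bullet> (\<Phi> (\<eta> t) (\<xi> t) + \<gamma> *\<^sub>R (Q1, Q2)))"
proof -
  have in_dom: "\<theta> s \<in> \<Theta>" "\<eta> s \<in> Hp" if "s \<in> {0..T}" for s
    using flowD(1,2)[OF flow that] by auto
  note \<theta>t = in_dom(1)[OF t(2)]
  define d\<phi> where "d\<phi> = vector_derivative (\<lambda>s. \<phi> (\<eta> s)) (at t within {0..T})"
  define d\<psi> where "d\<psi> = vector_derivative (\<lambda>s. \<psi> (\<xi> s)) (at t within {0..T})"
  have d\<phi>: "d\<phi> \<in> Ktest" "((\<lambda>s. \<phi> (\<eta> s)) has_vector_derivative d\<phi>) (at t within {0..T})"
    using flowD(6,7)[OF flow t(2)] unfolding d\<phi>_def by (simp_all add: vector_derivative_works)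
  have "((\<lambda>s. (1 / sqrt lam) *\<^sub>R (sqrt lam *\<^sub>R \<psi> (\<xi> s))) has_vector_derivative (1 / sqrt lam) *\<^sub>R Q2)
      (at t within {0..T})"
    by (rule bounded_linear.has_vector_derivative[OF bounded_linear_scaleR_right Q2])
  then have "((\<lambda>s. \<psi> (\<xi> s)) has_vector_derivative (1 / sqrt lam) *\<^sub>R Q2) (at t within {0..T})"
    using sqrt_lam(2) by simp
  then have "d\<psi> = (1 / sqrt lam) *\<^sub>R Q2"
    unfolding d\<psi>_def using t
    by (intro vector_derivative_within_cbox[of 0 T, unfolded cbox_interval])
  then have Q2_eq: "Q2 = sqrt lam *\<^sub>R d\<psi>" using sqrt_lam(2) by simp
  \<comment> \<open>\<open>W\<close> replaces \<open>Md ext\<close>: it involves the velocity of \<open>Md \<circ> \<phi> \<circ> \<eta>\<close>\<close>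
  define W where "W = Md (\<phi> (\<eta> t)) + \<gamma> *\<^sub>R Q1"
  define s where "s = \<psi> (\<xi> t) + \<gamma> *\<^sub>R d\<psi>"
  define ext where "ext = \<phi> (\<eta> t) + \<gamma> *\<^sub>R d\<phi>"
  have ext: "ext \<in> Ktest"
    unfolding ext_def using d\<phi> \<phi>_Ktest in_dom(2)[OF t(2)] Ktest
    by (auto intro: subspace_add subspace_scale)
  have "span (range (\<lambda>k. partial_deriv (\<lambda>\<eta>. Md (\<phi> \<eta>)) k (\<eta> t))) \<subseteq> Kttest"
    using Md_partial[OF in_dom(2)[OF t(2)]] by (intro span_minimal Kttest) auto
  then have "Q1 \<in> Kttest" using Q1(1) by (rule subsetD)
  then have W: "W \<in> Kttest"
    unfolding W_def using Md_linear \<phi>_Ktest in_dom(2)[OF t(2)] Kttest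
    by (auto simp: linear_op_on_def intro!: subspace_add subspace_scale)
  have Md_ext: "Lt v \<bullet> Md ext = Lt v \<bullet> W" if "v \<in> Ht" for v
  proof -
    have "Md ext = Md (\<phi> (\<eta> t)) + \<gamma> *\<^sub>R Md d\<phi>"
      unfolding ext_def using Md_linear d\<phi> \<phi>_Ktest in_dom(2)[OF t(2)] Ktest
      by (auto simp: linear_op_on_def subspace_scale)
    moreover have "Lt v \<bullet> Md d\<phi> = Lt v \<bullet> Q1"
      by (rule Md_commutes_weakly_with_time_derivative[OF t _ d\<phi>(2,1) Q1(2) Lt_in_Kt[OF that]])
        (intro \<phi>_Ktest in_dom)
    ultimately show ?thesis by (simp add: W_def inner_add_right)
  qed
  obtain D where D: "((\<lambda>q. Mp (u q - us)) has_derivative D) (at (\<theta> t))"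
    using Mp_diff[OF \<theta>t] by (auto simp: differentiable_def)
  obtain D' where D': "((\<lambda>q. B (u q - us)) has_derivative D') (at (\<theta> t))"
    using B_diff[OF \<theta>t] by (auto simp: differentiable_def)
  have DU: "(U has_derivative (\<lambda>h. (D h, sqrt lam *\<^sub>R D' h))) (at (\<theta> t))"
    unfolding primal_error_def by (auto intro!: derivative_eq_intros D D')
  let ?e = "\<lambda>k. (D (axis k 1), sqrt lam *\<^sub>R D' (axis k 1))"
  have partials: "partial_deriv (\<lambda>q. Mp (u q)) k (\<theta> t) = D (axis k 1)"
    "partial_deriv (\<lambda>q. B (u q)) k (\<theta> t) = D' (axis k 1)" for k
    by (rule trans[OF partial_deriv_add_const[where c = "Mp us", OF Mp_diff[OF \<theta>t]] partial_deriv_eq[OF D]],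
        simp add: Mp_diff_us)
      (rule trans[OF partial_deriv_add_const[where c = "B us", OF B_diff[OF \<theta>t]] partial_deriv_eq[OF D']],
        simp add: B_diff_us)
  have tangent: "primal_tangent Mp B lam u (\<theta> t) = span (range ?e)"
    by (simp add: primal_tangent_def partials)
  have D_Ht: "D (axis k 1) \<in> Ht" for k
    using Mp_partial[OF \<theta>t, of k] by (simp add: partial_deriv_eq[OF D])
  define w where "w = - (Lt_adj W, sqrt lam *\<^sub>R s)"
  have grad: "grad (\<lambda>q. E (u q) ext s) (\<theta> t) = - (\<chi> k. ?e k \<bullet> w)"
    unfolding grad_primal[OF \<theta>t ext]
    by (simp add: vec_eq_iff w_def partial_deriv_eq[OF D] partial_deriv_eq[OF D'] Md_ext D_Ht
        Lt_adjoint W sqrt_lam)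
  have "(\<theta> has_vector_derivative - (pinv (gram_primal Mp B lam u (\<theta> t)) *v
      grad (\<lambda>q. E (u q) ext s) (\<theta> t))) (at t within {0..T})"
    using flowD(8)[OF flow t(2)] unfolding ext_def s_def d\<phi>_def d\<psi>_def .
  moreover have "gram_primal Mp B lam u (\<theta> t) = (\<chi> i j. ?e i \<bullet> ?e j)"
    by (simp add: gram_primal_def partials sqrt_lam)
  moreover have "A *v (- v) = - (A *v v)" for A :: "real^'p^'p" and v
    using matrix_vector_mult_diff_distrib[of A 0 v] by simp
  ultimately have "(\<theta> has_vector_derivative pinv (\<chi> i j. ?e i \<bullet> ?e j) *v (\<chi> k. ?e k \<bullet> w))
      (at t within {0..T})" by (simp only: grad minus_minus)
  then obtain P where P: "P \<in> span (range ?e)" "w - P \<in> (span (range ?e))\<^sup>\<bottom>"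
    "((\<lambda>s. U (\<theta> s)) has_vector_derivative P) (at t within {0..T})"
    by (rule natural_gradient_velocity[where x = \<theta>, OF DU])
  have "V \<bullet> P = - (LL V \<bullet> (\<Phi> (\<eta> t) (\<xi> t) + \<gamma> *\<^sub>R (Q1, Q2)))"
    if V: "V \<in> primal_tangent Mp B lam u (\<theta> t)" for V
  proof -
    have "V \<bullet> P = V \<bullet> w"
      using P(2) V by (auto simp: tangent orthogonal_comp_def orthogonal_def inner_diff_right)
    also have "\<dots> = - (Lt (fst V) \<bullet> W + snd V \<bullet> (sqrt lam *\<^sub>R s))"
      using Lt_adjoint[OF fst_primal_tangent_in_Ht[OF \<theta>t V] W] by (simp add: w_def inner_prod_def)
    also have "\<dots> = - (LL V \<bullet> (\<Phi> (\<eta> t) (\<xi> t) + \<gamma> *\<^sub>R (Q1, Q2)))"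
      by (simp add: inner_prod_def dual_pair_def W_def s_def Q2_eq algebra_simps)
    finally show ?thesis .
  qed
  then show thesis using P by (intro that) (simp_all add: tangent)
qed

end

section \<open>Exponential decay\<close>

text \<open>Up to the factor \<open>(max L1 1)\<^sup>2 \<gamma> \<nu>\<close>, the gap condition says that the determinant of the
  symmetric matrix with diagonal \<open>\<Gamma>\<^sub>U\<^sub>U\<close>, \<open>\<Gamma>\<^sub>\<Phi>\<^sub>\<Phi>\<close> and off-diagonal entries \<open>\<Gamma>\<^sub>\<Phi>\<^sub>U / 2\<close> is positive.
  The diagonal entries are positive as well, so both eigenvalues are; the rate is the smaller.\<close>

lemma Gamma_conditions_imp_rate_pos:
  assumes pos: "0 < L0" "0 < \<gamma>" "0 < \<nu>"
    and small: "\<alpha> + \<beta>1 < 1 / (kappa_tilde L0 L1)\<^sup>2" "\<beta>2 < 1"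
    and gap: "(1 / (kappa_tilde L0 L1)\<^sup>2 - (\<alpha> + \<beta>1)) * (1 - \<beta>2)
         > ((1 + \<beta>1) * \<gamma> * \<nu> + \<beta>2 + \<alpha> * \<bar>1 - \<gamma> * \<nu>\<bar>)\<^sup>2 / (4 * \<gamma> * \<nu>)"
  shows "0 < npdg_rate L0 L1 \<gamma> \<nu> \<alpha> \<beta>1 \<beta>2"
proof -
  define m M where "m = min L0 1" and "M = max L1 (1::real)"
  define K where "K = 1 / (kappa_tilde L0 L1)\<^sup>2 - (\<alpha> + \<beta>1)"
  define c where "c = (1 + \<beta>1) * \<gamma> * \<nu> + \<beta>2 + \<alpha> * \<bar>1 - \<gamma> * \<nu>\<bar>"
  define a b where "a = Gamma_UU L0 L1 \<gamma> \<alpha> \<beta>1" and "b = Gamma_PhiPhi \<nu> \<beta>2"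
  have mM: "0 < m" "0 < M" using pos by (auto simp: m_def M_def)
  have "M\<^sup>2 * (1 / (kappa_tilde L0 L1)\<^sup>2) = m\<^sup>2"
    using mM by (simp add: kappa_tilde_def m_def[symmetric] M_def[symmetric] power_divide)
  then have "M\<^sup>2 * K = m\<^sup>2 - M\<^sup>2 * (\<alpha> + \<beta>1)"
    unfolding K_def right_diff_distrib by simp
  then have a: "a = \<gamma> * M\<^sup>2 * K"
    unfolding a_def Gamma_UU_def m_def[symmetric] M_def[symmetric] by (metis mult.assoc)
  have b: "b = \<nu> * (1 - \<beta>2)" by (simp add: b_def Gamma_PhiPhi_def)
  have "0 < a" "0 < b" using small pos mM by (simp_all add: a b K_def)
  have "c\<^sup>2 < 4 * \<gamma> * \<nu> * (K * (1 - \<beta>2))"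
    using gap pos unfolding K_def[symmetric] c_def[symmetric] by (simp add: divide_less_eq mult_ac)
  then have "M\<^sup>2 * c\<^sup>2 < M\<^sup>2 * (4 * \<gamma> * \<nu> * (K * (1 - \<beta>2)))"
    using mM by (intro mult_strict_left_mono) auto
  moreover have "Gamma_PhiU L1 \<gamma> \<nu> \<alpha> \<beta>1 \<beta>2 = - M * c"
    unfolding Gamma_PhiU_def c_def M_def ..
  moreover have "M\<^sup>2 * (4 * \<gamma> * \<nu> * (K * (1 - \<beta>2))) = 4 * (a * b)"
    unfolding a b by (simp add: algebra_simps)
  ultimately have "(Gamma_PhiU L1 \<gamma> \<nu> \<alpha> \<beta>1 \<beta>2)\<^sup>2 < 4 * (a * b)"
    by (simp add: power_mult_distrib)
  then have "(a - b)\<^sup>2 + (Gamma_PhiU L1 \<gamma> \<nu> \<alpha> \<beta>1 \<beta>2)\<^sup>2 < (a + b)\<^sup>2"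
    by (simp add: power2_eq_square algebra_simps)
  then have "sqrt ((a - b)\<^sup>2 + (Gamma_PhiU L1 \<gamma> \<nu> \<alpha> \<beta>1 \<beta>2)\<^sup>2) < a + b"
    using \<open>0 < a\<close> \<open>0 < b\<close> by (intro real_less_lsqrt) auto
  then show ?thesis
    by (simp add: npdg_rate_def a_def b_def)
qed

context npdg_problem
begin

definition energy :: "real^'p \<Rightarrow> real^'m \<Rightarrow> real^'x \<Rightarrow> real" where
  "energy q e x = ((norm (U q))\<^sup>2 + (norm (\<Phi> e x))\<^sup>2) / 2"

text \<open>The identity on the boundary component turns the constants of \<open>Lt\<close> into \<open>min L0 1\<close> and
  \<open>max L1 1\<close>.\<close>

lemma LL_bounds:
  assumes "fst V \<in> Ht"
  shows "min L0 1 * norm V \<le> norm (LL V)" "norm (LL V) \<le> max L1 1 * norm V"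
proof -
  obtain v b where V: "V = (v, b)" "v \<in> Ht" using assms by (cases V) auto
  have "(min L0 1)\<^sup>2 * (norm v)\<^sup>2 \<le> (norm (Lt v))\<^sup>2"
    unfolding power_mult_distrib[symmetric] using Lt_lower[OF V(2)] L0_pos
    by (intro power_mono order_trans[OF mult_right_mono Lt_lower[OF V(2)]]) auto
  moreover have "(min L0 1)\<^sup>2 * (norm b)\<^sup>2 \<le> 1 * (norm b)\<^sup>2"
    using L0_pos by (intro mult_right_mono) (auto intro: power_le_one)
  ultimately have "(min L0 1 * norm V)\<^sup>2 \<le> (norm (LL V))\<^sup>2"
    by (simp add: V norm_Pair power_mult_distrib distrib_left)
  then show "min L0 1 * norm V \<le> norm (LL V)" by (rule power2_le_imp_le) simp
  have "(norm (Lt v))\<^sup>2 \<le> (max L1 1)\<^sup>2 * (norm v)\<^sup>2"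
    unfolding power_mult_distrib[symmetric]
    by (intro power_mono order_trans[OF Lt_upper[OF V(2)] mult_right_mono]) auto
  moreover have "1 * (norm b)\<^sup>2 \<le> (max L1 1)\<^sup>2 * (norm b)\<^sup>2"
    by (intro mult_right_mono) (auto intro: one_le_power)
  ultimately have "(norm (LL V))\<^sup>2 \<le> (max L1 1 * norm V)\<^sup>2"
    by (simp add: V norm_Pair power_mult_distrib distrib_left)
  then show "norm (LL V) \<le> max L1 1 * norm V" by (rule power2_le_imp_le) simp
qed

text \<open>The relative errors are norms of the parts of \<open>U\<close>, \<open>LL U\<close> and \<open>\<Phi>\<close> missed by the tangent
  spaces. After splitting these three vectors accordingly, the two projected velocities
  turn the derivative of the energy into the left-hand side of the algebraic dissipation
  inequality, and the resulting quadratic form is bounded by its least eigenvalue.\<close>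

lemma energy_dissipation:
  assumes flow: "flow T \<theta> \<eta> \<xi>" and t: "0 < T" "t \<in> {0..T}"
    and params: "\<alpha> \<in> {0..1}" "\<beta>1 \<in> {0..1}" "\<beta>2 \<in> {0..1}" "\<alpha> + \<beta>1 \<le> 1"
    and errors: "relative_errors Lt Mp Md B lam us u \<phi> \<psi> T \<theta> \<eta> \<xi> \<alpha> \<beta>1 \<beta>2"
  shows "\<exists>d. ((\<lambda>s. energy (\<theta> s) (\<eta> s) (\<xi> s)) has_real_derivative d) (at t within {0..T}) \<and>
    d \<le> - (2 * npdg_rate L0 L1 \<gamma> \<nu> \<alpha> \<beta>1 \<beta>2) * energy (\<theta> t) (\<eta> t) (\<xi> t)"
proof -
  let ?U = "U (\<theta> t)" and ?\<Phi> = "\<Phi> (\<eta> t) (\<xi> t)"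
  let ?dU = "primal_tangent Mp B lam u (\<theta> t)" and ?d\<Phi> = "dual_tangent Md lam \<phi> \<psi> (\<eta> t) (\<xi> t)"
  obtain Q1 Q2 where Q1: "Q1 \<in> span (range (\<lambda>k. partial_deriv (\<lambda>\<eta>. Md (\<phi> \<eta>)) k (\<eta> t)))"
    "((\<lambda>s. Md (\<phi> (\<eta> s))) has_vector_derivative Q1) (at t within {0..T})"
    and Q2: "((\<lambda>s. sqrt lam *\<^sub>R \<psi> (\<xi> s)) has_vector_derivative Q2) (at t within {0..T})"
    and Q: "(Q1, Q2) \<in> ?d\<Phi>" "LL ?U - \<nu> *\<^sub>R ?\<Phi> - (Q1, Q2) \<in> ?d\<Phi>\<^sup>\<bottom>"
    by (rule dual_velocity[OF flow t(2)])
  obtain P where P: "P \<in> ?dU" "((\<lambda>s. U (\<theta> s)) has_vector_derivative P) (at t within {0..T})"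
    "\<And>V. V \<in> ?dU \<Longrightarrow> V \<bullet> P = - (LL V \<bullet> (?\<Phi> + \<gamma> *\<^sub>R (Q1, Q2)))"
    by (rule primal_velocity[OF flow t Q1 Q2]) blast
  have \<Phi>': "((\<lambda>s. \<Phi> (\<eta> s) (\<xi> s)) has_vector_derivative (Q1, Q2)) (at t within {0..T})"
    unfolding dual_pair_def by (intro has_vector_derivative_Pair Q1 Q2)
  have sub: "subspace ?d\<Phi>" unfolding dual_tangent_def by (intro subspace_Times subspace_span)
  have split: "\<exists>a. a \<in> ?d\<Phi> \<and> z - a \<in> ?d\<Phi>\<^sup>\<bottom>" for z :: "'v \<times> 'b"
  proof -
    obtain a1 where "a1 \<in> span (range (\<lambda>k. partial_deriv (\<lambda>\<eta>. Md (\<phi> \<eta>)) k (\<eta> t)))"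
      "fst z - a1 \<in> (span (range (\<lambda>k. partial_deriv (\<lambda>\<eta>. Md (\<phi> \<eta>)) k (\<eta> t))))\<^sup>\<bottom>"
      by (rule span_range_decomposition)
    moreover obtain a2 where "a2 \<in> span (range (\<lambda>k. sqrt lam *\<^sub>R partial_deriv \<psi> k (\<xi> t)))"
      "snd z - a2 \<in> (span (range (\<lambda>k. sqrt lam *\<^sub>R partial_deriv \<psi> k (\<xi> t))))\<^sup>\<bottom>"
      by (rule span_range_decomposition)
    moreover have "z - (a1, a2) = (fst z - a1, snd z - a2)" by (cases z) simp
    ultimately show ?thesis
      unfolding dual_tangent_def by (intro exI[of _ "(a1, a2)"]) (auto intro: orthogonal_comp_Times)
  qed
  obtain A where A: "A \<in> ?d\<Phi>" "LL ?U - A \<in> ?d\<Phi>\<^sup>\<bottom>" using split by blast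
  obtain p where p: "p \<in> ?d\<Phi>" "?\<Phi> - p \<in> ?d\<Phi>\<^sup>\<bottom>" using split by blast
  have eq: "(LL ?U - \<nu> *\<^sub>R ?\<Phi>) - (A - \<nu> *\<^sub>R p) = (LL ?U - A) - \<nu> *\<^sub>R (?\<Phi> - p)"
    by (simp add: algebra_simps)
  have "(LL ?U - \<nu> *\<^sub>R ?\<Phi>) - (A - \<nu> *\<^sub>R p) \<in> ?d\<Phi>\<^sup>\<bottom>"
    unfolding eq by (intro subspace_diff subspace_scale subspace_orthogonal_comp A p)
  then have Q_eq: "(Q1, Q2) = A - \<nu> *\<^sub>R p"
    using Q A(1) p(1) sub by (intro projection_eqI[OF sub]) (auto intro: subspace_diff subspace_scale)
  obtain V where V: "V \<in> ?dU" "?U - V \<in> ?dU\<^sup>\<bottom>"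
    unfolding primal_tangent_def by (rule span_range_decomposition)
  have UHt: "fst ?U \<in> Ht" by (simp add: primal_error_def Mp_in_Ht)
  have VHt: "fst V \<in> Ht" using V(1) flowD(1)[OF flow t(2)] by (rule fst_primal_tangent_in_Ht[rotated])
  have EHt: "fst (?U - V) \<in> Ht" using UHt VHt Ht by (simp add: subspace_diff)
  have LL_diff: "LL ?U - LL (?U - V) = LL V"
    using linear_op_on_diff[OF Lt_linear Ht UHt VHt] by (cases V) (auto simp: prod_eq_iff)
  have small: "norm (?U - V) \<le> \<alpha> * norm ?U" "norm (LL ?U - A) \<le> \<beta>1 * norm (LL ?U)"
    "norm (?\<Phi> - p) \<le> \<beta>2 * norm ?\<Phi>"
    using bspec[OF errors[unfolded relative_errors_def Let_def] t(2),
        unfolded orth_proj_orthogonal_comp[OF V] orth_proj_orthogonal_comp[OF A]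
          orth_proj_orthogonal_comp[OF p]] by auto
  have "norm (LL (?U - V)) \<le> max L1 1 * norm (?U - V)" by (rule LL_bounds(2)[OF EHt])
  also have "\<dots> \<le> max L1 1 * (\<alpha> * norm ?U)" using small(1) by (intro mult_left_mono) auto
  finally have nE: "norm (LL (?U - V)) \<le> max L1 1 * \<alpha> * norm ?U" by simp
  have orth: "x \<bullet> y = 0" if "x \<in> ?d\<Phi>" "y \<in> ?d\<Phi>\<^sup>\<bottom>" for x y
    using that by (auto simp: orthogonal_comp_def orthogonal_def)
  have "?U \<bullet> P = V \<bullet> P"
    using V(2) P(1) by (auto simp: orthogonal_comp_def orthogonal_def inner_diff_left inner_diff_right inner_commute)
  also have "\<dots> = - (LL ?U - LL (?U - V)) \<bullet> (?\<Phi> + \<gamma> *\<^sub>R (A - \<nu> *\<^sub>R p))"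
    using P(3)[OF V(1)] by (simp add: LL_diff Q_eq)
  finally have "?U \<bullet> P + ?\<Phi> \<bullet> (Q1, Q2) =
      - (LL ?U - LL (?U - V)) \<bullet> (?\<Phi> + \<gamma> *\<^sub>R (A - \<nu> *\<^sub>R p)) + ?\<Phi> \<bullet> (A - \<nu> *\<^sub>R p)"
    by (simp add: Q_eq)
  also have "\<dots> \<le> - (\<gamma> * ((min L0 1)\<^sup>2 - (max L1 1)\<^sup>2 * (\<alpha> + \<beta>1)) * (norm ?U)\<^sup>2
        - max L1 1 * ((1 + \<beta>1) * \<gamma> * \<nu> + \<beta>2 + \<alpha> * \<bar>1 - \<gamma> * \<nu>\<bar>) * (norm ?U * norm ?\<Phi>)
        + \<nu> * (1 - \<beta>2) * (norm ?\<Phi>)\<^sup>2)"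
    using A p params \<gamma>_pos \<nu>_pos L0_pos small nE LL_bounds[OF UHt]
    by (intro dissipation_inequality[where R = "LL ?U - A" and q = "?\<Phi> - p"] orth) auto
  also have "\<dots> = - (Gamma_UU L0 L1 \<gamma> \<alpha> \<beta>1 * (norm ?U)\<^sup>2
        + Gamma_PhiU L1 \<gamma> \<nu> \<alpha> \<beta>1 \<beta>2 * (norm ?U * norm ?\<Phi>)
        + Gamma_PhiPhi \<nu> \<beta>2 * (norm ?\<Phi>)\<^sup>2)"
    by (simp add: Gamma_UU_def Gamma_PhiU_def Gamma_PhiPhi_def)
  also have "\<dots> \<le> - (npdg_rate L0 L1 \<gamma> \<nu> \<alpha> \<beta>1 \<beta>2 * ((norm ?U)\<^sup>2 + (norm ?\<Phi>)\<^sup>2))"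
    unfolding npdg_rate_def by (simp only: neg_le_iff_le quadratic_form_ge_least_eigenvalue)
  also have "\<dots> = - (2 * npdg_rate L0 L1 \<gamma> \<nu> \<alpha> \<beta>1 \<beta>2) * energy (\<theta> t) (\<eta> t) (\<xi> t)"
    by (simp add: energy_def)
  finally have le: "?U \<bullet> P + ?\<Phi> \<bullet> (Q1, Q2)
      \<le> - (2 * npdg_rate L0 L1 \<gamma> \<nu> \<alpha> \<beta>1 \<beta>2) * energy (\<theta> t) (\<eta> t) (\<xi> t)" .
  have half_square: "((\<lambda>s. (norm (f s))\<^sup>2 / 2) has_real_derivative f t \<bullet> f') (at t within {0..T})"
    if "(f has_vector_derivative f') (at t within {0..T})" for f :: "real \<Rightarrow> 'v \<times> 'b" and f'
    using that unfolding has_vector_derivative_def has_field_derivative_def power2_norm_eq_inner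
    by (auto intro!: derivative_eq_intros simp: inner_commute algebra_simps)
  have "((\<lambda>s. energy (\<theta> s) (\<eta> s) (\<xi> s)) has_real_derivative ?U \<bullet> P + ?\<Phi> \<bullet> (Q1, Q2))
      (at t within {0..T})"
    using DERIV_add[OF half_square[OF P(2)] half_square[OF \<Phi>']]
    by (simp add: energy_def add_divide_distrib)
  with le show ?thesis by blast
qed

text \<open>The energy carries the factor one half, so its dissipation rate is twice the least eigenvalue.\<close>

lemma primal_error_decay:
  assumes flow: "flow T \<theta> \<eta> \<xi>" and T: "0 < T" and t: "t \<in> {0..T}"
    and params: "\<alpha> \<in> {0..1}" "\<beta>1 \<in> {0..1}" "\<beta>2 \<in> {0..1}" "\<alpha> + \<beta>1 \<le> 1"
    and errors: "relative_errors Lt Mp Md B lam us u \<phi> \<psi> T \<theta> \<eta> \<xi> \<alpha> \<beta>1 \<beta>2"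
  shows "(norm (Mp (u (\<theta> t) - us)))\<^sup>2 + lam * (norm (B (u (\<theta> t) - us)))\<^sup>2
    \<le> 2 * exp (- (2 * npdg_rate L0 L1 \<gamma> \<nu> \<alpha> \<beta>1 \<beta>2) * t) * energy (\<theta> 0) (\<eta> 0) (\<xi> 0)"
proof -
  have "\<forall>s\<in>{0..T}. \<exists>d. ((\<lambda>s. energy (\<theta> s) (\<eta> s) (\<xi> s)) has_real_derivative d) (at s within {0..T}) \<and>
      d \<le> - (2 * npdg_rate L0 L1 \<gamma> \<nu> \<alpha> \<beta>1 \<beta>2) * energy (\<theta> s) (\<eta> s) (\<xi> s)"
    by (intro ballI energy_dissipation[OF flow T _ params errors])
  from bchoice[OF this] obtain d where "\<forall>s\<in>{0..T}.
      ((\<lambda>s. energy (\<theta> s) (\<eta> s) (\<xi> s)) has_real_derivative d s) (at s within {0..T}) \<and>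
      d s \<le> - (2 * npdg_rate L0 L1 \<gamma> \<nu> \<alpha> \<beta>1 \<beta>2) * energy (\<theta> s) (\<eta> s) (\<xi> s)"
    by blast
  then have "energy (\<theta> t) (\<eta> t) (\<xi> t)
      \<le> exp (- (2 * npdg_rate L0 L1 \<gamma> \<nu> \<alpha> \<beta>1 \<beta>2) * t) * energy (\<theta> 0) (\<eta> 0) (\<xi> 0)"
    by (intro gronwall_exponential_decay[OF _ _ t, where d = d]) auto
  moreover have "(norm (U (\<theta> t)))\<^sup>2 \<le> 2 * energy (\<theta> t) (\<eta> t) (\<xi> t)" by (simp add: energy_def)
  moreover have "(norm (U (\<theta> t)))\<^sup>2 =
      (norm (Mp (u (\<theta> t) - us)))\<^sup>2 + lam * (norm (B (u (\<theta> t) - us)))\<^sup>2"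
    using lam_pos by (simp add: primal_error_def norm_Pair power_mult_distrib)
  ultimately show ?thesis by simp
qed

lemma energy_nonneg: "0 \<le> energy q e x"
  by (simp add: energy_def)

end

theorem theorem7:
  fixes \<Omega> :: "(real^'d) set"
    and val :: "'h::{real_inner,complete_space} \<Rightarrow> real^'d \<Rightarrow> real"
    and repl :: "'l::{real_inner,complete_space} \<Rightarrow> real^'d \<Rightarrow> real"
    and repv :: "'v::{real_inner,complete_space} \<Rightarrow> real^'d \<Rightarrow> real^'r"
    and repb :: "'b::{real_inner,complete_space} \<Rightarrow> real^'d \<Rightarrow> real"
    and K Ktest :: "'l set" and Kb Kbtest :: "'b set" and Ht Kt Kttest :: "'v set"
    and ipK :: "'l \<Rightarrow> 'l \<Rightarrow> real" and ipKb :: "'b \<Rightarrow> 'b \<Rightarrow> real"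
    and L :: "'h \<Rightarrow> 'l" and B :: "'h \<Rightarrow> 'b" and Mp :: "'h \<Rightarrow> 'v"
    and Lt Lt_adj :: "'v \<Rightarrow> 'v" and Mds :: "'v \<Rightarrow> 'l" and Md :: "'l \<Rightarrow> 'v"
    and f :: 'l and g :: 'b and us :: 'h
    and L0 L1 \<gamma> \<nu> lam :: real
    and \<Theta> :: "(real^'p) set" and Hp :: "(real^'m) set" and \<Xi> :: "(real^'x) set"
    and u :: "real^'p \<Rightarrow> 'h" and \<phi> :: "real^'m \<Rightarrow> 'l" and \<psi> :: "real^'x \<Rightarrow> 'b"
  assumes "open \<Omega>" "connected \<Omega>" "\<Omega> \<noteq> {}" "bounded \<Omega>" "lipschitz_boundary \<Omega>"
    and "function_space_on \<Omega> val"
    and "l2_space (lebesgue_on \<Omega>) repl"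
    and "l2_space (lebesgue_on \<Omega>) repv"
    and "l2_space (surface_measure \<Omega>) repb"
    and "hilbert_subspace K ipK" "hilbert_subspace Kb ipKb"
    and "subspace Ht" "subspace Kt" "subspace Kttest" "subspace Ktest" "subspace Kbtest"
    and "linear_op_on UNIV K L" "linear_op_on UNIV Kb B"
    and "linear_op_on UNIV Ht Mp" "linear_op_on Ht Kt Lt"
    and "linear_op_on Kt K Mds" "linear_op_on Ktest Kttest Md"
    and "\<And>w. L w = Mds (Lt (Mp w))"
    and "\<And>w p. w \<in> Kt \<Longrightarrow> p \<in> Ktest \<Longrightarrow> Mds w \<bullet> p = w \<bullet> Md p"
    and "0 < L0" "L0 \<le> L1"
    and "\<And>w. w \<in> Ht \<Longrightarrow> L0 * norm w \<le> norm (Lt w) \<and> norm (Lt w) \<le> L1 * norm w"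
    and "\<And>v w. v \<in> Ht \<Longrightarrow> w \<in> Kttest \<Longrightarrow> Lt v \<bullet> w = v \<bullet> Lt_adj w"
    and "L us = f" "B us = g"
    and "open \<Theta>" "open Hp" "open \<Xi>"
    and "\<And>\<eta>. \<eta> \<in> Hp \<Longrightarrow> \<phi> \<eta> \<in> Ktest"
    and "\<And>\<xi>. \<xi> \<in> \<Xi> \<Longrightarrow> \<psi> \<xi> \<in> Kbtest"
    and "\<And>\<theta>. \<theta> \<in> \<Theta> \<Longrightarrow> (\<lambda>\<theta>. Mp (u \<theta> - us)) differentiable (at \<theta>)"
    and "\<And>\<theta> k. \<theta> \<in> \<Theta> \<Longrightarrow> partial_deriv (\<lambda>\<theta>. Mp (u \<theta> - us)) k \<theta> \<in> Ht"
    and "\<And>\<theta>. \<theta> \<in> \<Theta> \<Longrightarrow> (\<lambda>\<theta>. B (u \<theta> - us)) differentiable (at \<theta>)"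
    and "\<And>\<theta> k. \<theta> \<in> \<Theta> \<Longrightarrow> partial_deriv (\<lambda>\<theta>. B (u \<theta> - us)) k \<theta> \<in> Kb"
    and "\<And>\<eta>. \<eta> \<in> Hp \<Longrightarrow> (\<lambda>\<eta>. Md (\<phi> \<eta>)) differentiable (at \<eta>)"
    and "\<And>\<eta> k. \<eta> \<in> Hp \<Longrightarrow> partial_deriv (\<lambda>\<eta>. Md (\<phi> \<eta>)) k \<eta> \<in> Kttest"
    and "\<And>\<xi>. \<xi> \<in> \<Xi> \<Longrightarrow> \<psi> differentiable (at \<xi>)"
    and "\<And>\<xi> k. \<xi> \<in> \<Xi> \<Longrightarrow> partial_deriv \<psi> k \<xi> \<in> Kbtest"
    and "\<gamma> > 0" "\<nu> > 0" "lam > 0"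
  shows "\<exists>C\<^sub>0 :: real^'p \<Rightarrow> real^'m \<Rightarrow> real^'x \<Rightarrow> real.
    (\<forall>\<theta>\<^sub>0 \<eta>\<^sub>0 \<xi>\<^sub>0. C\<^sub>0 \<theta>\<^sub>0 \<eta>\<^sub>0 \<xi>\<^sub>0 \<ge> 0) \<and>
    (\<forall>T \<theta> \<eta> \<xi> \<alpha> \<beta>1 \<beta>2.
       T > 0 \<and>
       npdg_flow (npdg_functional Lt Mp Md B f g \<nu> lam) Mp Md B Ktest \<gamma> lam \<Theta> Hp \<Xi> u \<phi> \<psi> T \<theta> \<eta> \<xi> \<and>
       \<alpha> \<in> {0..1} \<and> \<beta>1 \<in> {0..1} \<and> \<beta>2 \<in> {0..1} \<and>
       relative_errors Lt Mp Md B lam us u \<phi> \<psi> T \<theta> \<eta> \<xi> \<alpha> \<beta>1 \<beta>2 \<and>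
       \<alpha> + \<beta>1 < 1 / (kappa_tilde L0 L1)\<^sup>2 \<and> \<beta>2 < 1 \<and>
       (1 / (kappa_tilde L0 L1)\<^sup>2 - (\<alpha> + \<beta>1)) * (1 - \<beta>2)
         > ((1 + \<beta>1) * \<gamma> * \<nu> + \<beta>2 + \<alpha> * \<bar>1 - \<gamma> * \<nu>\<bar>)\<^sup>2 / (4 * \<gamma> * \<nu>)
       \<longrightarrow>
       (\<exists>r>0. r = npdg_rate L0 L1 \<gamma> \<nu> \<alpha> \<beta>1 \<beta>2 \<and>
          (\<forall>t\<in>{0..T}.
             (norm (Mp (u (\<theta> t) - us)))\<^sup>2 + lam * (norm (B (u (\<theta> t) - us)))\<^sup>2
               \<le> 2 * exp (- r * t) * C\<^sub>0 (\<theta> 0) (\<eta> 0) (\<xi> 0))))"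
proof -
  interpret npdg_problem Ktest Ht Kt Kttest B Mp Lt Lt_adj Mds Md us L0 L1 \<gamma> \<nu> lam \<Theta> Hp \<Xi> u \<phi> \<psi>
  proof
    show "linear_op_on UNIV UNIV B"
      using \<open>linear_op_on UNIV Kb B\<close> by (simp add: linear_op_on_def)
    show "L0 * norm w \<le> norm (Lt w)" "norm (Lt w) \<le> L1 * norm w" if "w \<in> Ht" for w
      using \<open>\<And>w. w \<in> Ht \<Longrightarrow> L0 * norm w \<le> norm (Lt w) \<and> norm (Lt w) \<le> L1 * norm w\<close> that by auto
  qed fact+
  have data: "f = Mds (Lt (Mp us))" "g = B us"
    using \<open>L us = f\<close> \<open>B us = g\<close> \<open>\<And>w. L w = Mds (Lt (Mp w))\<close> by auto
  have \<kappa>_ge_1: "1 / (kappa_tilde L0 L1)\<^sup>2 \<le> 1"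
  proof -
    have "1 \<le> kappa_tilde L0 L1" using L0_pos by (auto simp: kappa_tilde_def)
    then show ?thesis by (simp add: one_le_power)
  qed
  \<comment> \<open>the constant is the energy of the initial parameters, so it does not depend on the flow\<close>
  show ?thesis
  proof (intro exI[of _ energy] conjI allI impI energy_nonneg, elim conjE)
    fix T \<theta> \<eta> \<xi> \<alpha> \<beta>1 \<beta>2
    assume T: "(0::real) < T"
      and flow: "npdg_flow (npdg_functional Lt Mp Md B f g \<nu> lam) Mp Md B Ktest \<gamma> lam \<Theta> Hp \<Xi> u \<phi> \<psi> T \<theta> \<eta> \<xi>"
      and params: "\<alpha> \<in> {0..1}" "\<beta>1 \<in> {0..1}" "\<beta>2 \<in> {0..1}"
      and errors: "relative_errors Lt Mp Md B lam us u \<phi> \<psi> T \<theta> \<eta> \<xi> \<alpha> \<beta>1 \<beta>2"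
      and small: "\<alpha> + \<beta>1 < 1 / (kappa_tilde L0 L1)\<^sup>2" "\<beta>2 < 1"
      and gap: "(1 / (kappa_tilde L0 L1)\<^sup>2 - (\<alpha> + \<beta>1)) * (1 - \<beta>2)
         > ((1 + \<beta>1) * \<gamma> * \<nu> + \<beta>2 + \<alpha> * \<bar>1 - \<gamma> * \<nu>\<bar>)\<^sup>2 / (4 * \<gamma> * \<nu>)"
    define r where "r = npdg_rate L0 L1 \<gamma> \<nu> \<alpha> \<beta>1 \<beta>2"
    have "0 < r"
      unfolding r_def by (rule Gamma_conditions_imp_rate_pos[OF L0_pos \<gamma>_pos \<nu>_pos small gap])
    moreover have "(norm (Mp (u (\<theta> t) - us)))\<^sup>2 + lam * (norm (B (u (\<theta> t) - us)))\<^sup>2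
        \<le> 2 * exp (- r * t) * energy (\<theta> 0) (\<eta> 0) (\<xi> 0)" if t: "t \<in> {0..T}" for t
    proof -
      have "\<alpha> + \<beta>1 \<le> 1" using small \<kappa>_ge_1 by simp
      from primal_error_decay[OF flow[unfolded data] T t params this errors]
      have "(norm (Mp (u (\<theta> t) - us)))\<^sup>2 + lam * (norm (B (u (\<theta> t) - us)))\<^sup>2
          \<le> 2 * exp (- (2 * r) * t) * energy (\<theta> 0) (\<eta> 0) (\<xi> 0)"
        by (simp add: r_def)
      \<comment> \<open>the energy argument gives twice the claimed rate\<close>
      also have "\<dots> \<le> 2 * exp (- r * t) * energy (\<theta> 0) (\<eta> 0) (\<xi> 0)"
        using \<open>0 < r\<close> t by (intro mult_right_mono energy_nonneg) (auto simp: mult_right_mono)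
      finally show ?thesis .
    qed
    ultimately show "\<exists>r>0. r = npdg_rate L0 L1 \<gamma> \<nu> \<alpha> \<beta>1 \<beta>2 \<and>
        (\<forall>t\<in>{0..T}. (norm (Mp (u (\<theta> t) - us)))\<^sup>2 + lam * (norm (B (u (\<theta> t) - us)))\<^sup>2
          \<le> 2 * exp (- r * t) * energy (\<theta> 0) (\<eta> 0) (\<xi> 0))"
      unfolding r_def by blast
  qed
qed

end
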